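(* Let $\mathcal S=(G=(V,E),q,b,A)$ be a spin system which exhibits strong spatial mixing with rate $f$, and suppose $|S_\ell(v)|\le g(\ell)$ for all $v\in V$ and all $\ell$. Let $\ell\in\mathbb N$ be such that $q\cdot f(\ell)\cdot g(\ell)\le\alpha<1$. Then for all $v\in V$, $\Lambda\subset V$ (with $v\notin\Lambda$) and $\sigma\in\Omega_\Lambda$ with $\mu_\Lambda(\sigma)>0$, the expected total number of calls to $\textsc{ssms}$ made by $\textsc{ssms}(\mathcal S,(\Lambda,\sigma),v,\ell)$ (including the initial call) is at most $\frac1{1-\alpha}$.
   Context: A spin system $\mathcal S=(G,q,b,A)$: $G=(V,E)$ a countable, locally finite graph, $q\in\mathbb N$ spins, field $b:[q]\to\mathbb R$, symmetric interaction $A:[q]\times[q]\to\mathbb R$; configurations on $W$ are $\Omega_W=[q]^W$. A Gibbs measure $\mu$ is a probability measure on $[q]^V$ whose conditional distribution on any finite $W$ given the spins on $\partial W=\{u\notin W: u\text{ adjacent to }W\}$ is proportional to $\prod_{w\in W}b(\sigma_w)\prod A(\sigma_x,\sigma_y)$ over edges $\{x,y\}$ meeting $W$. $\mu_W$ is the marginal on $W$; $(W,\tau)$ is feasible if $\mu_W(\tau)>0$; $\mu_W^{\tau}=\mu_W^{(\Lambda,\tau)}$ is the conditional marginal on $W$ given spins $\tau$ on $\Lambda$; $\mu_v=\mu_{\{v\}}$; $\oplus$ is concatenation of partial configurations. $d_G$ is graph distance, $S_\ell(v)=\{w: d_G(v,w)=\ell\}$. Strong spatial mixing with rate $f:\mathbb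 N\to\mathbb R^+$: for all $W\subset V$ with $V\setminus W$ finite, all $v\in V\setminus W$ and all feasible $\tau^1\ne\tau^2\in\Omega_W$, $d_{\mathrm{TV}}(\mu_v^{\tau^1},\mu_v^{\tau^2})\le f(\ell)$ where $\ell=\min\{d_G(v,w): w\in W,\ \tau^1_w\ne\tau^2_w\}$. (This implies $\mu$ is the unique Gibbs measure.) Algorithm $\textsc{ssms}(\mathcal S,(\Lambda,\sigma),v,\ell)$, input a partial configuration $\sigma\in\Omega_\Lambda$, a vertex $v\notin\Lambda$, $\ell\in\mathbb N$: let $S=S_\ell(v)$; for $i\in[q]$ set $p_v^i=\min_{\tau\in\Omega_{S\setminus\Lambda}}\mu_v^{\sigma\oplus\tau}(i)$ and $I_i=[\sum_{j<i}p_v^j,\sum_{j\le i}p_v^j)$; set $p_v^0=1-\sum_{i\in[q]}p_v^i$ and $I_0=[1-p_v^0,1]$. Draw $y\sim U[0,1]$. If $y\in I_i$ for some $i\in[q]$, return $(\Lambda,\sigma)\oplus(v,i)$. Otherwise (if $y\in I_0$): order $S\setminus\Lambda=\{w_1,\dots,w_m\}$, set $(\Lambda',\sigma')=(\Lambda,\sigma)$ and for $j=1,\dots,m$ successively replace $(\Lambda',\sigma')$ by $\textsc{ssms}(\mathcal S,(\Lambda',\sigma'),w_j,\ell)$; then for $i\in[q]$ let $\rho_v^i=\mu_v^{\sigma'}(i)-p_v^i$ and $J_i=[\sum_{j\in[q]}p_v^j+\sum_{k<i}\rho_v^k,\ \sum_{j\in[q]}p_v^j+\sum_{k\le i}\rho_v^k)$;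 find $i$ with $y\in J_i$ and return $(\Lambda,\sigma)\oplus(v,i)$ (the spins assigned during the recursive calls are discarded).
   Formalization: Feasible is read as: every finite restriction has positive probability (literally, SSM would be vacuous on infinite graphs and the claim false), with conditional marginals as limits; the minimum in p_v^i runs over feasible boundary spins only; and ℓ ≥ 1, since at ℓ = 0 the recursion never ends. *)

theory Defs
  imports "HOL-Probability.Probability"
begin

section \<open>Spin systems and configurations\<close>

text \<open>The set of spins is \<open>{1..q}\<close>; the index 0 is left free because the algorithm uses it for the
  zone of indecision.\<close>

record 'v spin_system =
  verts :: "'v set"
  edges :: "'v set set"
  nspins :: nat
  spin_field :: "nat \<Rightarrow> real"
  interaction :: "nat \<Rightarrow> nat \<Rightarrow> real"

abbreviation spins :: "'v spin_system \<Rightarrow> nat set" where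
  "spins S \<equiv> {1..nspins S}"

definition spin_system :: "'v spin_system \<Rightarrow> bool" where
  "spin_system S \<longleftrightarrow>
     countable (verts S) \<and>
     (\<forall>e\<in>edges S. e \<subseteq> verts S \<and> card e = 2) \<and>
     (\<forall>v\<in>verts S. finite {e\<in>edges S. v \<in> e}) \<and>
     1 \<le> nspins S \<and>
     (\<forall>i\<in>spins S. \<forall>j\<in>spins S. interaction S i j = interaction S j i)"

text \<open>A partial configuration \<open>(\<Lambda>, \<sigma>)\<close> is a map with domain \<open>\<Lambda>\<close>, so that concatenation is \<open>++\<close>
  and \<open>(\<Lambda>, \<sigma>) \<oplus> (v, i)\<close> is \<open>\<sigma>(v \<mapsto> i)\<close>.\<close>

type_synonym 'v config = "'v \<rightharpoonup> nat"

definition configs :: "'v spin_system \<Rightarrow> 'v set \<Rightarrow> 'v config set" where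
  "configs S W = {\<sigma>. dom \<sigma> = W \<and> ran \<sigma> \<subseteq> spins S}"

definition extends :: "('v \<Rightarrow> nat) \<Rightarrow> 'v config \<Rightarrow> bool" where
  "extends \<omega> \<sigma> \<longleftrightarrow> \<sigma> \<subseteq>\<^sub>m (\<lambda>w. Some (\<omega> w))"

definition boundary :: "'v spin_system \<Rightarrow> 'v set \<Rightarrow> 'v set" where
  "boundary S W = {u \<in> verts S - W. \<exists>w\<in>W. {u, w} \<in> edges S}"

definition gdist :: "'v spin_system \<Rightarrow> 'v \<Rightarrow> 'v \<Rightarrow> enat" where
  "gdist S v w = (INF n \<in> {n. (v, w) \<in> {(x, y). {x, y} \<in> edges S} ^^ n}. enat n)"

definition gsphere :: "'v spin_system \<Rightarrow> 'v \<Rightarrow> nat \<Rightarrow> 'v set" where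
  "gsphere S v l = {w \<in> verts S. gdist S v w = enat l}"


section \<open>Gibbs measures\<close>

text \<open>By the symmetry of the interaction the two orderings of an edge give the same value.\<close>

definition edge_weight :: "'v spin_system \<Rightarrow> 'v config \<Rightarrow> 'v set \<Rightarrow> real" where
  "edge_weight S \<sigma> e = (THE a. \<exists>x y. e = {x, y} \<and> a = interaction S (the (\<sigma> x)) (the (\<sigma> y)))"

definition weight :: "'v spin_system \<Rightarrow> 'v set \<Rightarrow> 'v config \<Rightarrow> real" where
  "weight S W \<sigma> = (\<Prod>w\<in>W. spin_field S (the (\<sigma> w))) *
     (\<Prod>e\<in>{e\<in>edges S. e \<inter> W \<noteq> {}}. edge_weight S \<sigma> e)"

definition marginal :: "('v \<Rightarrow> nat) measure \<Rightarrow> 'v config \<Rightarrow> real" where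
  "marginal \<mu> \<sigma> = \<P>(\<omega> in \<mu>. extends \<omega> \<sigma>)"

definition gibbs_measure :: "'v spin_system \<Rightarrow> ('v \<Rightarrow> nat) measure \<Rightarrow> bool" where
  "gibbs_measure S \<mu> \<longleftrightarrow>
     prob_space \<mu> \<and>
     sets \<mu> = sets (PiM (verts S) (\<lambda>_. count_space (spins S))) \<and>
     (\<forall>W \<tau>. finite W \<and> W \<subseteq> verts S \<and> \<tau> \<in> configs S (boundary S W) \<and> marginal \<mu> \<tau> > 0 \<longrightarrow>
        (\<exists>c. \<forall>\<eta>\<in>configs S W.
           \<P>(\<omega> in \<mu>. extends \<omega> \<eta> \<bar> extends \<omega> \<tau>) = c * weight S W (\<eta> ++ \<tau>)))"

text \<open>On an infinite domain a single configuration usually has probability 0. Feasibility therefore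
  asks that all finite restrictions have positive probability, and the conditional marginal
  \<open>\<mu>\<^sub>v\<^sup>\<tau>(i)\<close> is the limit of the elementary conditional probabilities given the finite restrictions
  of \<open>\<tau>\<close>. On a finite domain feasibility is \<open>\<mu>\<^sub>\<Lambda>(\<tau>) > 0\<close>, and whenever \<open>\<mu>\<^sub>\<Lambda>(\<tau>) > 0\<close> the conditional
  marginal is the elementary conditional probability given \<open>\<tau>\<close>; both are shown below. On a cofinite
  domain the net of conditional probabilities of a feasible \<open>\<tau>\<close> is eventually constant, by the
  Markov property of a Gibbs measure.\<close>

definition feasible :: "('v \<Rightarrow> nat) measure \<Rightarrow> 'v config \<Rightarrow> bool" where
  "feasible \<mu> \<tau> \<longleftrightarrow> (\<forall>U. finite U \<and> U \<subseteq> dom \<tau> \<longrightarrow> marginal \<mu> (\<tau> |` U) > 0)"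

definition cond_marginal :: "('v \<Rightarrow> nat) measure \<Rightarrow> 'v config \<Rightarrow> 'v \<Rightarrow> nat \<Rightarrow> real" where
  "cond_marginal \<mu> \<tau> v i =
     Lim (finite_subsets_at_top (dom \<tau>)) (\<lambda>U. \<P>(\<omega> in \<mu>. \<omega> v = i \<bar> extends \<omega> (\<tau> |` U)))"


section \<open>Strong spatial mixing\<close>

definition d_TV :: "'v spin_system \<Rightarrow> (nat \<Rightarrow> real) \<Rightarrow> (nat \<Rightarrow> real) \<Rightarrow> real" where
  "d_TV S p r = (\<Sum>i\<in>spins S. \<bar>p i - r i\<bar>) / 2"

text \<open>If the two configurations disagree only outside the component of \<open>v\<close>, the distance is infinite
  and there is no constraint.\<close>

definition strong_spatial_mixing ::
    "'v spin_system \<Rightarrow> ('v \<Rightarrow> nat) measure \<Rightarrow> (nat \<Rightarrow> real) \<Rightarrow> bool" where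
  "strong_spatial_mixing S \<mu> f \<longleftrightarrow>
     (\<forall>W v \<tau>1 \<tau>2 l. W \<subseteq> verts S \<and> finite (verts S - W) \<and> v \<in> verts S - W \<and>
        \<tau>1 \<in> configs S W \<and> \<tau>2 \<in> configs S W \<and> feasible \<mu> \<tau>1 \<and> feasible \<mu> \<tau>2 \<and> \<tau>1 \<noteq> \<tau>2 \<and>
        (INF w \<in> {w\<in>W. \<tau>1 w \<noteq> \<tau>2 w}. gdist S v w) = enat l \<longrightarrow>
        d_TV S (cond_marginal \<mu> \<tau>1 v) (cond_marginal \<mu> \<tau>2 v) \<le> f l)"


section \<open>The algorithm\<close>

text \<open>The minimum ranges over those \<open>\<tau>\<close> for which the conditional marginal makes sense.\<close>

definition p_low ::
    "'v spin_system \<Rightarrow> ('v \<Rightarrow> nat) measure \<Rightarrow> nat \<Rightarrow> 'v config \<Rightarrow> 'v \<Rightarrow> nat \<Rightarrow> real" where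
  "p_low S \<mu> l \<sigma> v i =
     Min ((\<lambda>\<tau>. cond_marginal \<mu> (\<sigma> ++ \<tau>) v i) `
       {\<tau> \<in> configs S (gsphere S v l - dom \<sigma>). feasible \<mu> (\<sigma> ++ \<tau>)})"

definition I_zone ::
    "'v spin_system \<Rightarrow> ('v \<Rightarrow> nat) measure \<Rightarrow> nat \<Rightarrow> 'v config \<Rightarrow> 'v \<Rightarrow> nat \<Rightarrow> real set" where
  "I_zone S \<mu> l \<sigma> v i =
     {(\<Sum>j\<in>{1..<i}. p_low S \<mu> l \<sigma> v j) ..< (\<Sum>j\<in>{1..i}. p_low S \<mu> l \<sigma> v j)}"

definition rho ::
    "'v spin_system \<Rightarrow> ('v \<Rightarrow> nat) measure \<Rightarrow> nat \<Rightarrow> 'v config \<Rightarrow> 'v config \<Rightarrow> 'v \<Rightarrow> nat \<Rightarrow> real" where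
  "rho S \<mu> l \<sigma> \<sigma>' v i = cond_marginal \<mu> \<sigma>' v i - p_low S \<mu> l \<sigma> v i"

definition J_zone ::
    "'v spin_system \<Rightarrow> ('v \<Rightarrow> nat) measure \<Rightarrow> nat \<Rightarrow> 'v config \<Rightarrow> 'v config \<Rightarrow> 'v \<Rightarrow> nat \<Rightarrow> real set"
  where
  "J_zone S \<mu> l \<sigma> \<sigma>' v i =
     {(\<Sum>j\<in>spins S. p_low S \<mu> l \<sigma> v j) + (\<Sum>k\<in>{1..<i}. rho S \<mu> l \<sigma> \<sigma>' v k) ..<
      (\<Sum>j\<in>spins S. p_low S \<mu> l \<sigma> v j) + (\<Sum>k\<in>{1..i}. rho S \<mu> l \<sigma> \<sigma>' v k)}"

text \<open>A run reads its uniform variates from a tape of independent draws, one per call. It yields the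
  configuration returned, the number of calls made and the unread part of the tape, or \<open>None\<close> if
  it does not terminate. The configuration is threaded through successive calls by \<open>call_seq\<close>.\<close>

type_synonym 'v outcome = "('v config \<times> nat \<times> real stream) option"

primrec call_seq ::
    "('v config \<Rightarrow> 'v \<Rightarrow> real stream \<Rightarrow> 'v outcome) \<Rightarrow> 'v list \<Rightarrow> 'v config \<Rightarrow> real stream \<Rightarrow> 'v outcome"
  where
  "call_seq F [] \<sigma> ys = Some (\<sigma>, 0, ys)"
| "call_seq F (w # ws) \<sigma> ys =
     Option.bind (F \<sigma> w ys) (\<lambda>(\<sigma>', n, ys').
     Option.bind (call_seq F ws \<sigma>' ys') (\<lambda>(\<sigma>'', n', ys'').
     Some (\<sigma>'', n + n', ys'')))"

lemma call_seq_mono [partial_function_mono]: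
  assumes "\<And>\<sigma> w ys. mono_option (\<lambda>f. F f \<sigma> w ys)"
  shows "mono_option (\<lambda>f. call_seq (F f) ws \<sigma> ys)"
proof (induction ws arbitrary: \<sigma> ys)
  case Nil
  show ?case by (simp add: option.const_mono)
next
  case (Cons w ws)
  show ?case
    unfolding call_seq.simps
    apply (rule bind_mono[OF assms])
    apply (clarsimp split: prod.split)
    apply (rule bind_mono[OF Cons.IH])
    apply (clarsimp simp: option.const_mono split: prod.split)
    done
qed

text \<open>The argument \<open>enum \<sigma> v\<close> lists \<open>S\<^sub>\<ell>(v) - \<Lambda>\<close> in the order in which it is visited. For
  feasible \<open>\<sigma>\<close> the spin selected by \<open>SOME\<close> in either branch is unique whenever it exists, and in the
  second branch it fails to exist only for \<open>y = 1\<close>, a null event.\<close>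

partial_function (option) ssms ::
    "'v spin_system \<Rightarrow> ('v \<Rightarrow> nat) measure \<Rightarrow> ('v config \<Rightarrow> 'v \<Rightarrow> 'v list) \<Rightarrow> nat \<Rightarrow>
     'v config \<Rightarrow> 'v \<Rightarrow> real stream \<Rightarrow> 'v outcome"
  where
  "ssms S \<mu> enum l \<sigma> v ys =
     (let y = shd ys in
      if \<exists>i\<in>spins S. y \<in> I_zone S \<mu> l \<sigma> v i
      then Some (\<sigma>(v \<mapsto> SOME i. i \<in> spins S \<and> y \<in> I_zone S \<mu> l \<sigma> v i), 1, stl ys)
      else
        Option.bind (call_seq (\<lambda>\<sigma>' w ys'. ssms S \<mu> enum l \<sigma>' w ys') (enum \<sigma> v) \<sigma> (stl ys))
          (\<lambda>(\<sigma>', n, ys').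
            Some (\<sigma>(v \<mapsto> SOME i. i \<in> spins S \<and> y \<in> J_zone S \<mu> l \<sigma> \<sigma>' v i), 1 + n, ys')))"

definition ssms_calls ::
    "'v spin_system \<Rightarrow> ('v \<Rightarrow> nat) measure \<Rightarrow> ('v config \<Rightarrow> 'v \<Rightarrow> 'v list) \<Rightarrow> nat \<Rightarrow>
     'v config \<Rightarrow> 'v \<Rightarrow> real stream \<Rightarrow> ennreal" where
  "ssms_calls S \<mu> enum l \<sigma> v ys =
     (case ssms S \<mu> enum l \<sigma> v ys of None \<Rightarrow> \<infinity> | Some (_, n, _) \<Rightarrow> of_nat n)"

definition expected_ssms_calls ::
    "'v spin_system \<Rightarrow> ('v \<Rightarrow> nat) measure \<Rightarrow> ('v config \<Rightarrow> 'v \<Rightarrow> 'v list) \<Rightarrow> nat \<Rightarrow>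
     'v config \<Rightarrow> 'v \<Rightarrow> ennreal" where
  "expected_ssms_calls S \<mu> enum l \<sigma> v =
     (\<integral>\<^sup>+ ys. ssms_calls S \<mu> enum l \<sigma> v ys \<partial>stream_space (uniform_measure lborel {0..1}))"


section \<open>Consistency of the conventions\<close>

lemma edge_weight_doubleton:
  assumes "spin_system S" "\<sigma> x = Some i" "\<sigma> y = Some j" "i \<in> spins S" "j \<in> spins S"
  shows "edge_weight S \<sigma> {x, y} = interaction S i j"
proof -
  have sym: "interaction S i j = interaction S j i"
    using assms unfolding spin_system_def by blast
  show ?thesis
    unfolding edge_weight_def
  proof (rule the_equality)
    show "\<exists>x' y'. {x, y} = {x', y'} \<and>
        interaction S i j = interaction S (the (\<sigma> x')) (the (\<sigma> y'))"
      using assms by (intro exI[of _ x] exI[of _ y]) simp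
  next
    fix a
    assume "\<exists>x' y'. {x, y} = {x', y'} \<and> a = interaction S (the (\<sigma> x')) (the (\<sigma> y'))"
    then show "a = interaction S i j"
      using assms sym by (auto simp: doubleton_eq_iff)
  qed
qed

lemma extends_iff: "extends \<omega> \<sigma> \<longleftrightarrow> (\<forall>w\<in>dom \<sigma>. \<sigma> w = Some (\<omega> w))"
  by (auto simp: extends_def map_le_def)

lemma extends_restrict_iff: "extends \<omega> (\<sigma> |` U) \<longleftrightarrow> (\<forall>w\<in>dom \<sigma> \<inter> U. \<sigma> w = Some (\<omega> w))"
  by (auto simp: extends_iff)

lemma measurable_extends:
  assumes "gibbs_measure S \<mu>" "countable (verts S)" "dom \<sigma> \<subseteq> verts S"
  shows "{\<omega> \<in> space \<mu>. extends \<omega> \<sigma>} \<in> sets \<mu>"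
proof -
  have sets: "sets \<mu> = sets (PiM (verts S) (\<lambda>_. count_space (spins S)))"
    using assms by (simp add: gibbs_measure_def)
  have cnt: "countable (dom \<sigma>)" using assms countable_subset by blast
  have "{\<omega> \<in> space \<mu>. \<forall>w\<in>dom \<sigma>. \<omega> w \<in> {the (\<sigma> w)}} \<in> sets \<mu>"
  proof (rule sets.sets_Collect_countable_All'[OF _ cnt])
    fix w assume w: "w \<in> dom \<sigma>"
    have "(\<lambda>\<omega>. \<omega> w) \<in> measurable (PiM (verts S) (\<lambda>_. count_space (spins S)))
        (count_space (spins S))"
      using w assms by (intro measurable_component_singleton) auto
    then have m: "(\<lambda>\<omega>. \<omega> w) \<in> measurable \<mu> (count_space (spins S))"
      using measurable_cong_sets[OF sets refl] by blast
    have "(\<lambda>\<omega>. \<omega> w) -` ({the (\<sigma> w)} \<inter> spins S) \<inter> space \<mu> \<in> sets \<mu>"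
      by (rule measurable_sets[OF m]) simp
    moreover have "(\<lambda>\<omega>. \<omega> w) -` ({the (\<sigma> w)} \<inter> spins S) \<inter> space \<mu> =
        {\<omega> \<in> space \<mu>. \<omega> w \<in> {the (\<sigma> w)}}"
      using measurable_space[OF m] by (fastforce simp del: atLeastAtMost_iff)
    ultimately show "{\<omega> \<in> space \<mu>. \<omega> w \<in> {the (\<sigma> w)}} \<in> sets \<mu>" by simp
  qed
  moreover have "{\<omega> \<in> space \<mu>. \<forall>w\<in>dom \<sigma>. \<omega> w \<in> {the (\<sigma> w)}} = {\<omega> \<in> space \<mu>. extends \<omega> \<sigma>}"
    by (force simp: extends_iff)
  ultimately show ?thesis by simp
qed

lemma marginal_restrict_mono:
  assumes "gibbs_measure S \<mu>" "countable (verts S)" "dom \<sigma> \<subseteq> verts S"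
  shows "marginal \<mu> \<sigma> \<le> marginal \<mu> (\<sigma> |` U)"
proof -
  interpret prob_space \<mu> using assms by (simp add: gibbs_measure_def)
  show ?thesis
    unfolding marginal_def
  proof (rule finite_measure_mono)
    show "{\<omega> \<in> space \<mu>. extends \<omega> \<sigma>} \<subseteq> {\<omega> \<in> space \<mu>. extends \<omega> (\<sigma> |` U)}"
      by (auto simp: extends_restrict_iff extends_iff)
    show "{\<omega> \<in> space \<mu>. extends \<omega> (\<sigma> |` U)} \<in> sets \<mu>"
      using assms by (intro measurable_extends[of S]) auto
  qed
qed

lemma feasible_if_marginal_pos:
  assumes "gibbs_measure S \<mu>" "countable (verts S)" "dom \<sigma> \<subseteq> verts S" "marginal \<mu> \<sigma> > 0"
  shows "feasible \<mu> \<sigma>"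
  using marginal_restrict_mono[OF assms(1-3)] assms(4) by (auto simp: feasible_def intro: less_le_trans)

lemma restrict_map_dom: "\<sigma> |` dom \<sigma> = \<sigma>"
  by (auto simp: restrict_map_def fun_eq_iff dom_def)

lemma feasible_finite:
  assumes "gibbs_measure S \<mu>" "countable (verts S)" "dom \<sigma> \<subseteq> verts S" "finite (dom \<sigma>)"
  shows "feasible \<mu> \<sigma> \<longleftrightarrow> marginal \<mu> \<sigma> > 0"
proof
  assume "feasible \<mu> \<sigma>"
  then have "marginal \<mu> (\<sigma> |` dom \<sigma>) > 0"
    using assms(4) unfolding feasible_def by blast
  then show "marginal \<mu> \<sigma> > 0" by (simp add: restrict_map_dom)
qed (rule feasible_if_marginal_pos[OF assms(1-3)])

lemma cond_marginal_finite:
  assumes "finite (dom \<tau>)"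
  shows "cond_marginal \<mu> \<tau> v i = \<P>(\<omega> in \<mu>. \<omega> v = i \<bar> extends \<omega> \<tau>)"
  unfolding cond_marginal_def
proof (rule tendsto_Lim)
  have "\<forall>\<^sub>F U in finite_subsets_at_top (dom \<tau>). U = dom \<tau>"
    unfolding eventually_finite_subsets_at_top using assms by (intro exI[of _ "dom \<tau>"]) auto
  then have "\<forall>\<^sub>F U in finite_subsets_at_top (dom \<tau>).
      \<P>(\<omega> in \<mu>. \<omega> v = i \<bar> extends \<omega> (\<tau> |` U)) = \<P>(\<omega> in \<mu>. \<omega> v = i \<bar> extends \<omega> \<tau>)"
    by eventually_elim (simp add: restrict_map_dom)
  then show "((\<lambda>U. \<P>(\<omega> in \<mu>. \<omega> v = i \<bar> extends \<omega> (\<tau> |` U))) \<longlongrightarrow>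
      \<P>(\<omega> in \<mu>. \<omega> v = i \<bar> extends \<omega> \<tau>)) (finite_subsets_at_top (dom \<tau>))"
    by (rule tendsto_eventually)
qed simp

lemma prob_extends_restrict_tendsto:
  assumes "gibbs_measure S \<mu>" "countable (verts S)" "dom \<tau> \<subseteq> verts S" "A \<in> sets \<mu>"
  shows "((\<lambda>U. measure \<mu> {\<omega> \<in> space \<mu>. \<omega> \<in> A \<and> extends \<omega> (\<tau> |` U)}) \<longlongrightarrow>
    measure \<mu> {\<omega> \<in> space \<mu>. \<omega> \<in> A \<and> extends \<omega> \<tau>}) (finite_subsets_at_top (dom \<tau>))"
proof (cases "dom \<tau> = {}")
  case True
  then have "\<tau> = Map.empty" by simp
  then show ?thesis by simp
next
  case False
  interpret prob_space \<mu> using assms by (simp add: gibbs_measure_def)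
  have cnt: "countable (dom \<tau>)" using assms countable_subset by blast
  define E where "E U = {\<omega> \<in> space \<mu>. \<omega> \<in> A \<and> extends \<omega> (\<tau> |` U)}" for U
  define F where "F = {\<omega> \<in> space \<mu>. \<omega> \<in> A \<and> extends \<omega> \<tau>}"
  define V where "V n = from_nat_into (dom \<tau>) ` {..<n}" for n :: nat
  have meas: "E U \<in> sets \<mu>" for U
  proof -
    have "E U = A \<inter> {\<omega> \<in> space \<mu>. extends \<omega> (\<tau> |` U)}"
      using sets.sets_into_space[OF assms(4)] by (auto simp: E_def)
    also have "\<dots> \<in> sets \<mu>"
      using assms by (intro sets.Int measurable_extends[of S]) auto
    finally show ?thesis .
  qed
  have anti: "E U' \<subseteq> E U" if "U \<subseteq> U'" for U U'
    using that by (auto simp: E_def extends_restrict_iff)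
  have sub: "F \<subseteq> E U" for U
    by (auto simp: E_def F_def extends_restrict_iff extends_iff)
  have rng: "range (from_nat_into (dom \<tau>)) = dom \<tau>"
    by (rule range_from_nat_into[OF False cnt])
  have V: "finite (V n)" "V n \<subseteq> dom \<tau>" for n
    using from_nat_into[OF False] by (auto simp: V_def)
  have "(\<Inter>n. E (V n)) \<subseteq> F"
  proof
    fix \<omega> assume \<omega>: "\<omega> \<in> (\<Inter>n. E (V n))"
    have "\<tau> w = Some (\<omega> w)" if "w \<in> dom \<tau>" for w
    proof -
      have "w \<in> range (from_nat_into (dom \<tau>))" using that by (simp only: rng)
      then obtain k where "w = from_nat_into (dom \<tau>) k" by (rule rangeE)
      then have "w \<in> V (Suc k)" by (auto simp: V_def)
      moreover have "extends \<omega> (\<tau> |` V (Suc k))" using \<omega> by (auto simp: E_def)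
      ultimately show ?thesis using that by (auto simp: extends_restrict_iff)
    qed
    then have "extends \<omega> \<tau>" by (simp add: extends_iff)
    then show "\<omega> \<in> F" using \<omega> by (auto simp: F_def E_def)
  qed
  then have Int: "(\<Inter>n. E (V n)) = F" using sub by blast
  have "(\<lambda>n. measure \<mu> (E (V n))) \<longlonglongrightarrow> measure \<mu> (\<Inter>n. E (V n))"
  proof (rule finite_Lim_measure_decseq)
    show "range (\<lambda>n. E (V n)) \<subseteq> sets \<mu>" using meas by auto
    show "decseq (\<lambda>n. E (V n))"
      by (intro antimonoI anti) (auto simp: V_def)
  qed
  then have lim: "(\<lambda>n. measure \<mu> (E (V n))) \<longlonglongrightarrow> measure \<mu> F" by (simp add: Int)
  have "((\<lambda>U. measure \<mu> (E U)) \<longlongrightarrow> measure \<mu> F) (finite_subsets_at_top (dom \<tau>))"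
  proof (rule order_tendstoI)
    fix a assume a: "a < measure \<mu> F"
    have "a < measure \<mu> (E U)" for U
      using a finite_measure_mono[OF sub meas, of U] by linarith
    then show "\<forall>\<^sub>F U in finite_subsets_at_top (dom \<tau>). a < measure \<mu> (E U)" by simp
  next
    fix a assume "measure \<mu> F < a"
    then have "\<forall>\<^sub>F n in sequentially. measure \<mu> (E (V n)) < a"
      using lim by (rule order_tendstoD(2)[rotated])
    then obtain n where n: "measure \<mu> (E (V n)) < a" by (auto simp: eventually_sequentially)
    have "measure \<mu> (E U) < a" if "V n \<subseteq> U" for U
      using n finite_measure_mono[OF anti[OF that] meas] by linarith
    then show "\<forall>\<^sub>F U in finite_subsets_at_top (dom \<tau>). measure \<mu> (E U) < a"
      unfolding eventually_finite_subsets_at_top using V by (intro exI[of _ "V n"]) auto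
  qed
  then show ?thesis by (simp add: E_def F_def)
qed

lemma cond_marginal_pos:
  assumes "gibbs_measure S \<mu>" "countable (verts S)" "dom \<tau> \<subseteq> verts S" "marginal \<mu> \<tau> > 0"
    "v \<in> verts S"
  shows "cond_marginal \<mu> \<tau> v i = \<P>(\<omega> in \<mu>. \<omega> v = i \<bar> extends \<omega> \<tau>)"
proof -
  define A where "A = {\<omega> \<in> space \<mu>. \<omega> v = i}"
  have A: "A \<in> sets \<mu>"
  proof -
    have "A = {\<omega> \<in> space \<mu>. extends \<omega> [v \<mapsto> i]}" by (auto simp: A_def extends_iff)
    then show ?thesis using measurable_extends[OF assms(1,2), of "[v \<mapsto> i]"] assms(5) by simp
  qed
  note 1 = prob_extends_restrict_tendsto[OF assms(1-3) A]
  note 2 = prob_extends_restrict_tendsto[OF assms(1-3) sets.top]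
  have AA: "{\<omega> \<in> space \<mu>. \<omega> \<in> A \<and> extends \<omega> \<sigma>} = {\<omega> \<in> space \<mu>. \<omega> v = i \<and> extends \<omega> \<sigma>}"
    "{\<omega> \<in> space \<mu>. \<omega> \<in> space \<mu> \<and> extends \<omega> \<sigma>} = {\<omega> \<in> space \<mu>. extends \<omega> \<sigma>}" for \<sigma>
    by (auto simp: A_def)
  have "measure \<mu> {\<omega> \<in> space \<mu>. \<omega> \<in> space \<mu> \<and> extends \<omega> \<tau>} \<noteq> 0"
    using assms(4) by (simp add: marginal_def AA)
  from tendsto_divide[OF 1 2 this] show ?thesis
    unfolding cond_marginal_def cond_prob_def AA by (intro tendsto_Lim) auto
qed

end

theory Submission
  imports Defs
begin

text \<open>If \<open>y < 1 - q * f \<ell>\<close>, then strong spatial mixing guarantees that \<open>y\<close> lies outside the zone of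
  indecision, so that the call returns at once; otherwise it makes at most \<open>M = \<lfloor>g \<ell>\<rfloor>\<close>
  recursive calls. Reading the tape, the number of pending calls is therefore dominated, tape by
  tape, by the walk that starts at 1 and moves by \<open>-1\<close> or \<open>M - 1\<close> according to whether the next
  variate is below \<open>1 - q * f \<ell>\<close>. The expected hitting time of 0 of this walk, which has drift at
  most \<open>\<alpha> - 1\<close>, is at most \<open>1 / (1 - \<alpha>)\<close>.\<close>

section \<open>Configurations and graph distance\<close>

text \<open>Strong spatial mixing compares configurations on cofinite domains, whereas the algorithm
  compares fillings of one sphere on top of a \<open>\<sigma>\<close> with arbitrary domain. The
  Markov property bridges this: once the sphere is filled, the marginal at \<open>v\<close> depends
  only on spins in the ball and on its boundary, so both fillings may be continued to a cofinite
  domain. No continuation need have positive probability; a typical sample point provides a feasible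
  one. The factor \<open>q\<close> arises because each of the \<open>q\<close> minima
  \<open>p_low\<close> lies at most \<open>f l\<close> below the same probability vector.

  The recursive calls receive configurations that depend on earlier draws, and the number of calls
  might a priori be infinite, so a recursion for its expectation cannot simply be solved. But the
  threshold is uniform over all configurations of positive probability, and the run never leaves
  these. The comparison process can therefore forget the configuration altogether, and only its
  hitting time has to be integrated.\<close>

lemma gdist_less_iff:
  "gdist S v w < enat l \<longleftrightarrow> (\<exists>n<l. (v, w) \<in> {(x, y). {x, y} \<in> edges S} ^^ n)"
  by (auto simp: gdist_def INF_less_iff)

lemma edge_weight_cong:
  assumes "\<And>x. x \<in> e \<Longrightarrow> \<sigma> x = \<sigma>' x"
  shows "edge_weight S \<sigma> e = edge_weight S \<sigma>' e"
proof -
  have "(\<exists>x y. e = {x, y} \<and> a = interaction S (the (\<sigma> x)) (the (\<sigma> y))) \<longleftrightarrow>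
      (\<exists>x y. e = {x, y} \<and> a = interaction S (the (\<sigma>' x)) (the (\<sigma>' y)))" for a
    by (intro ex_cong1 conj_cong refl) (use assms in auto)
  then show ?thesis by (simp add: edge_weight_def)
qed

lemma finite_configs: "finite W \<Longrightarrow> finite (configs S W)"
  unfolding configs_def by (intro finite_set_of_finite_maps) auto

lemma extends_alt: "extends \<omega> \<sigma> \<longleftrightarrow> (\<forall>w i. \<sigma> w = Some i \<longrightarrow> \<omega> w = i)"
  unfolding extends_iff by (metis domD domI option.inject)

lemma configs_iff: "\<sigma> \<in> configs S W \<longleftrightarrow> dom \<sigma> = W \<and> (\<forall>w i. \<sigma> w = Some i \<longrightarrow> i \<in> spins S)"
  unfolding configs_def ran_def by blast

lemma configs_add:
  assumes "\<sigma> \<in> configs S A" "\<tau> \<in> configs S B"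
  shows "\<sigma> ++ \<tau> \<in> configs S (A \<union> B)"
  using assms unfolding configs_iff map_add_Some_iff dom_map_add by blast

lemma extends_add:
  assumes "dom \<sigma> \<inter> dom \<tau> = {}"
  shows "extends \<omega> (\<sigma> ++ \<tau>) \<longleftrightarrow> extends \<omega> \<sigma> \<and> extends \<omega> \<tau>"
proof -
  have "\<tau> w = None" if "\<sigma> w = Some i" for w i
    using assms that by blast
  then show ?thesis unfolding extends_alt map_add_Some_iff by blast
qed

lemma extends_upd:
  assumes "v \<notin> dom \<sigma>"
  shows "extends \<omega> (\<sigma>(v \<mapsto> i)) \<longleftrightarrow> \<omega> v = i \<and> extends \<omega> \<sigma>"
proof -
  have "w \<noteq> v" if "\<sigma> w = Some j" for w j
    using assms that by blast
  then show ?thesis unfolding extends_alt map_upd_Some_unfold by metis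
qed

lemma configs_restrict: "\<sigma> \<in> configs S A \<Longrightarrow> \<sigma> |` B \<in> configs S (A \<inter> B)"
  unfolding configs_iff by (auto simp: restrict_map_def split: if_splits)

lemma configs_upd: "\<sigma> \<in> configs S A \<Longrightarrow> i \<in> spins S \<Longrightarrow> \<sigma>(v \<mapsto> i) \<in> configs S (insert v A)"
  unfolding configs_iff map_upd_Some_unfold by auto

lemma configs_some: "\<sigma> \<in> configs S A \<Longrightarrow> x \<in> A \<Longrightarrow> \<exists>i\<in>spins S. \<sigma> x = Some i"
  unfolding configs_iff by blast

lemma restrict_split:
  assumes "dom \<rho> \<subseteq> B \<union> C"
  shows "\<rho> |` B ++ \<rho> |` C = \<rho>"
proof
  fix x show "(\<rho> |` B ++ \<rho> |` C) x = \<rho> x"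
    using assms by (cases "x \<in> C"; cases "\<rho> x") (auto simp: map_add_def restrict_map_def)
qed

lemma configs_dom: "\<sigma> \<in> configs S W \<Longrightarrow> dom \<sigma> = W"
  by (simp add: configs_def)

lemma restrict_Int_dom: "\<rho> |` (dom \<rho> \<inter> U) = \<rho> |` U"
  by (rule ext) (simp add: restrict_map_def domIff)

text \<open>The differences sum to 0, so the one at \<open>i\<close> is balanced by all the others
  together and makes up at most half of the total absolute difference. Thus the 1/2 in
  \<open>d_TV\<close> is absorbed and no factor 2 enters the threshold.\<close>

lemma abs_diff_le_d_TV:
  assumes "(\<Sum>i\<in>spins S. p i) = (\<Sum>i\<in>spins S. r i)" "i \<in> spins S"
  shows "\<bar>p i - r i\<bar> \<le> d_TV S p r"
proof -
  have "(\<Sum>j\<in>spins S. p j - r j) = 0" using assms(1) by (simp add: sum_subtractf)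
  then have "p i - r i = - (\<Sum>j\<in>spins S - {i}. p j - r j)"
    using sum.remove[OF _ assms(2), of "\<lambda>j. p j - r j"] by simp
  then have "\<bar>p i - r i\<bar> = \<bar>\<Sum>j\<in>spins S - {i}. p j - r j\<bar>"
    by (simp only: abs_minus_cancel)
  also have "\<dots> \<le> (\<Sum>j\<in>spins S - {i}. \<bar>p j - r j\<bar>)" by (rule sum_abs)
  finally have "\<bar>p i - r i\<bar> \<le> (\<Sum>j\<in>spins S - {i}. \<bar>p j - r j\<bar>)" .
  moreover have "(\<Sum>j\<in>spins S. \<bar>p j - r j\<bar>) = \<bar>p i - r i\<bar> + (\<Sum>j\<in>spins S - {i}. \<bar>p j - r j\<bar>)"
    by (rule sum.remove[OF _ assms(2)]) simp
  ultimately show ?thesis by (simp add: d_TV_def)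
qed

section \<open>Finiteness and locality in the graph\<close>

locale spin_graph =
  fixes S :: "'v spin_system"
  assumes sys: "spin_system S"
begin

lemma countable_verts: "countable (verts S)"
  using sys by (simp add: spin_system_def)

lemma edge_verts: "e \<in> edges S \<Longrightarrow> e \<subseteq> verts S"
  using sys by (simp add: spin_system_def)

lemma edgeD: "e \<in> edges S \<Longrightarrow> \<exists>x y. e = {x, y} \<and> x \<noteq> y"
  using sys by (metis spin_system_def card_2_iff)

lemma finite_incident: "finite W \<Longrightarrow> W \<subseteq> verts S \<Longrightarrow> finite {e \<in> edges S. e \<inter> W \<noteq> {}}"
proof -
  assume W: "finite W" "W \<subseteq> verts S"
  have "{e \<in> edges S. e \<inter> W \<noteq> {}} = (\<Union>w\<in>W. {e \<in> edges S. w \<in> e})" by auto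
  moreover have "finite {e \<in> edges S. w \<in> e}" if "w \<in> W" for w
    using sys W(2) that unfolding spin_system_def by blast
  ultimately show ?thesis using W(1) by simp
qed

lemma finite_edge: "e \<in> edges S \<Longrightarrow> finite e"
  using edgeD[of e] by auto

lemma finite_boundary:
  assumes "finite W" "W \<subseteq> verts S"
  shows "finite (boundary S W)"
proof (rule finite_subset)
  show "boundary S W \<subseteq> \<Union>{e \<in> edges S. e \<inter> W \<noteq> {}}"
    by (auto simp: boundary_def)
  show "finite (\<Union>{e \<in> edges S. e \<inter> W \<noteq> {}})"
    using finite_incident[OF assms] finite_edge by blast
qed

lemma boundary_verts: "boundary S W \<subseteq> verts S" "boundary S W \<inter> W = {}"
  by (auto simp: boundary_def)

text \<open>An edge has only two ends: if one lies in \<open>B\<close>, the other is in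
  \<open>B\<close> or in its boundary. Hence the weight on \<open>B\<close> sees nothing beyond the
  boundary.\<close>

lemma edge_closed:
  assumes "e \<in> edges S" "e \<inter> B \<noteq> {}"
  shows "e \<subseteq> B \<union> boundary S B"
proof
  fix x assume x: "x \<in> e"
  obtain w where w: "w \<in> e" "w \<in> B" using assms by auto
  obtain a b where "e = {a, b}" "a \<noteq> b" using edgeD[OF assms(1)] by blast
  then have "x = w \<or> e = {x, w}" using x w by auto
  then show "x \<in> B \<union> boundary S B"
    using w assms edge_verts[OF assms(1)] x by (auto simp: boundary_def)
qed

abbreviation "adj \<equiv> {(x, y). {x, y} \<in> edges S}"

text \<open>The inequality is strict so that the ball is disjoint from the sphere of radius
  \<open>l\<close> and has its boundary inside that sphere.\<close>

definition gball :: "'v \<Rightarrow> nat \<Rightarrow> 'v set" where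
  "gball v l = {w \<in> verts S. gdist S v w < enat l}"

lemma finite_relpow: "v \<in> verts S \<Longrightarrow> finite {w. (v, w) \<in> adj ^^ n} \<and> {w. (v, w) \<in> adj ^^ n} \<subseteq> verts S"
proof (induction n)
  case (Suc n)
  have eq: "{w. (v, w) \<in> adj ^^ Suc n} = (\<Union>u\<in>{w. (v, w) \<in> adj ^^ n}. {w. {u, w} \<in> edges S})"
    by auto
  have "finite {w. {u, w} \<in> edges S}" if "u \<in> verts S" for u
  proof (rule finite_subset)
    show "{w. {u, w} \<in> edges S} \<subseteq> \<Union>{e \<in> edges S. e \<inter> {u} \<noteq> {}}" by auto
    show "finite (\<Union>{e \<in> edges S. e \<inter> {u} \<noteq> {}})"
      using finite_incident[of "{u}"] that finite_edge by blast
  qed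
  moreover have "{w. {u, w} \<in> edges S} \<subseteq> verts S" for u using edge_verts by auto
  ultimately show ?case unfolding eq using Suc by blast
qed auto

lemma finite_gball: "v \<in> verts S \<Longrightarrow> finite (gball v l)"
proof (rule finite_subset)
  show "gball v l \<subseteq> (\<Union>n<l. {w. (v, w) \<in> adj ^^ n})"
    by (auto simp: gball_def gdist_less_iff)
qed (use finite_relpow in auto)

lemma gball_verts: "gball v l \<subseteq> verts S"
  by (auto simp: gball_def)

text \<open>The radius must be positive: the ball of radius 0 is empty, and the sphere of radius 0
  would contain \<open>v\<close> itself.\<close>

lemma center_in_gball: "v \<in> verts S \<Longrightarrow> 1 \<le> l \<Longrightarrow> v \<in> gball v l"
  by (auto simp: gball_def gdist_less_iff intro!: exI[of _ 0])

lemma gball_gsphere: "gball v l \<inter> gsphere S v l = {}"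
  by (auto simp: gball_def gsphere_def)

text \<open>A neighbour of a vertex at distance below \<open>l\<close> has distance at most
  \<open>l\<close>; outside the ball only \<open>l\<close> is left.\<close>

lemma boundary_gball: "boundary S (gball v l) \<subseteq> gsphere S v l"
proof
  fix u assume "u \<in> boundary S (gball v l)"
  then obtain w where u: "u \<in> verts S" "\<not> gdist S v u < enat l" and w: "gdist S v w < enat l"
    and e: "{u, w} \<in> edges S"
    by (auto simp: boundary_def gball_def)
  obtain n where n: "n < l" "(v, w) \<in> adj ^^ n" using w by (auto simp: gdist_less_iff)
  then have "(v, u) \<in> adj ^^ Suc n" using e by (auto simp: insert_commute)
  then have "gdist S v u < enat (Suc l)" using n unfolding gdist_less_iff by (meson Suc_mono)
  then show "u \<in> gsphere S v l" using u
    by (cases "gdist S v u") (auto simp: gsphere_def)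
qed

text \<open>The second factor involves no spin on \<open>B\<close>, so it stays constant as long as
  only those spins vary.\<close>

lemma weight_factor:
  assumes "finite W" "W \<subseteq> verts S" "B \<subseteq> W"
  shows "weight S W \<eta> = weight S B \<eta> *
     ((\<Prod>w\<in>W - B. spin_field S (the (\<eta> w))) *
      (\<Prod>e\<in>{e \<in> edges S. e \<inter> W \<noteq> {} \<and> e \<inter> B = {}}. edge_weight S \<eta> e))"
proof -
  have "(\<Prod>w\<in>W. spin_field S (the (\<eta> w))) =
      (\<Prod>w\<in>W - B. spin_field S (the (\<eta> w))) * (\<Prod>w\<in>B. spin_field S (the (\<eta> w)))"
    by (rule prod.subset_diff[OF assms(3,1)])
  moreover have "(\<Prod>e\<in>{e\<in>edges S. e \<inter> W \<noteq> {}}. edge_weight S \<eta> e) =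
     (\<Prod>e\<in>{e\<in>edges S. e \<inter> W \<noteq> {}} - {e\<in>edges S. e \<inter> B \<noteq> {}}. edge_weight S \<eta> e) *
     (\<Prod>e\<in>{e\<in>edges S. e \<inter> B \<noteq> {}}. edge_weight S \<eta> e)"
    by (rule prod.subset_diff) (use finite_incident[OF assms(1,2)] assms(3) in auto)
  moreover have "{e\<in>edges S. e \<inter> W \<noteq> {}} - {e\<in>edges S. e \<inter> B \<noteq> {}} =
      {e \<in> edges S. e \<inter> W \<noteq> {} \<and> e \<inter> B = {}}" by auto
  ultimately show ?thesis by (simp add: weight_def)
qed

lemma weight_cong:
  assumes "\<And>x. x \<in> B \<union> boundary S B \<Longrightarrow> \<eta> x = \<eta>' x"
  shows "weight S B \<eta> = weight S B \<eta>'"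
proof -
  have "(\<Prod>w\<in>B. spin_field S (the (\<eta> w))) = (\<Prod>w\<in>B. spin_field S (the (\<eta>' w)))"
    by (rule prod.cong) (use assms in auto)
  moreover have "(\<Prod>e\<in>{e\<in>edges S. e \<inter> B \<noteq> {}}. edge_weight S \<eta> e) =
     (\<Prod>e\<in>{e\<in>edges S. e \<inter> B \<noteq> {}}. edge_weight S \<eta>' e)"
    by (intro prod.cong edge_weight_cong assms) (use edge_closed in blast)+
  ultimately show ?thesis by (simp add: weight_def)
qed

end


section \<open>The Markov property\<close>

locale gibbs_system = spin_graph S for S :: "'v spin_system" +
  fixes \<mu> :: "('v \<Rightarrow> nat) measure"
  assumes gibbs: "gibbs_measure S \<mu>"
begin

sublocale prob_space \<mu>
  using gibbs by (simp add: gibbs_measure_def)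

lemma space_\<mu>: "space \<mu> = (\<Pi>\<^sub>E w\<in>verts S. spins S)"
proof -
  have "sets \<mu> = sets (PiM (verts S) (\<lambda>_. count_space (spins S)))"
    using gibbs by (simp add: gibbs_measure_def)
  from sets_eq_imp_space_eq[OF this] show ?thesis by (simp add: space_PiM)
qed

definition cyl :: "'v config \<Rightarrow> ('v \<Rightarrow> nat) set" where
  "cyl \<sigma> = {\<omega> \<in> space \<mu>. extends \<omega> \<sigma>}"

lemma marginal_cyl: "marginal \<mu> \<sigma> = measure \<mu> (cyl \<sigma>)"
  by (simp add: marginal_def cyl_def)

lemma cyl_sets: "dom \<sigma> \<subseteq> verts S \<Longrightarrow> cyl \<sigma> \<in> sets \<mu>"
  unfolding cyl_def by (rule measurable_extends[OF gibbs countable_verts])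

lemma restrict_point_config:
  assumes "\<omega> \<in> space \<mu>" "W \<subseteq> verts S"
  shows "(\<lambda>w. Some (\<omega> w)) |` W \<in> configs S W"
proof -
  have "\<omega> w \<in> spins S" if "w \<in> verts S" for w
    using assms(1) that unfolding space_\<mu> by (rule PiE_mem)
  then show ?thesis
    using assms(2) unfolding configs_iff by (auto simp: restrict_map_def simp del: atLeastAtMost_iff split: if_splits)
qed

lemma total_probability:
  assumes "finite T" "T \<subseteq> verts S" "A \<in> sets \<mu>"
  shows "measure \<mu> A = (\<Sum>\<tau>\<in>configs S T. measure \<mu> (A \<inter> cyl \<tau>))"
proof -
  have A: "A = (\<Union>\<tau>\<in>configs S T. A \<inter> cyl \<tau>)"
  proof
    show "A \<subseteq> (\<Union>\<tau>\<in>configs S T. A \<inter> cyl \<tau>)"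
    proof
      fix \<omega> assume \<omega>: "\<omega> \<in> A"
      then have sp: "\<omega> \<in> space \<mu>" using sets.sets_into_space[OF assms(3)] by blast
      have "(\<lambda>w. Some (\<omega> w)) |` T \<in> configs S T" by (rule restrict_point_config[OF sp assms(2)])
      moreover have "\<omega> \<in> cyl ((\<lambda>w. Some (\<omega> w)) |` T)"
        using sp by (auto simp: cyl_def extends_iff)
      ultimately show "\<omega> \<in> (\<Union>\<tau>\<in>configs S T. A \<inter> cyl \<tau>)" using \<omega> by blast
    qed
  qed auto
  have disj: "disjoint_family_on (\<lambda>\<tau>. A \<inter> cyl \<tau>) (configs S T)"
  proof (unfold disjoint_family_on_def, intro ballI impI)
    fix \<tau> \<tau>' assume t: "\<tau> \<in> configs S T" "\<tau>' \<in> configs S T" "\<tau> \<noteq> \<tau>'"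
    have False if "\<omega> \<in> cyl \<tau>" "\<omega> \<in> cyl \<tau>'" for \<omega>
    proof -
      have "\<tau> w = \<tau>' w" for w
      proof (cases "w \<in> T")
        case True
        then have "w \<in> dom \<tau>" "w \<in> dom \<tau>'"
          using t(1,2)[THEN configs_dom] by simp_all
        then show ?thesis using that unfolding cyl_def extends_iff by simp
      next
        case False
        then show ?thesis using t(1,2)[THEN configs_dom] by (metis domIff)
      qed
      then show False using t(3) by (simp add: fun_eq_iff)
    qed
    then show "(A \<inter> cyl \<tau>) \<inter> (A \<inter> cyl \<tau>') = {}" by blast
  qed
  have "measure \<mu> (\<Union>\<tau>\<in>configs S T. A \<inter> cyl \<tau>) = (\<Sum>\<tau>\<in>configs S T. measure \<mu> (A \<inter> cyl \<tau>))"
  proof (rule finite_measure_finite_Union[OF finite_configs[OF assms(1)] _ disj])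
    show "(\<lambda>\<tau>. A \<inter> cyl \<tau>) ` configs S T \<subseteq> events"
      by (intro image_subsetI sets.Int assms(3) cyl_sets) (use assms(2) configs_dom in blast)
  qed
  then show ?thesis using A by simp
qed

lemma cyl_add: "dom \<sigma> \<inter> dom \<tau> = {} \<Longrightarrow> cyl (\<sigma> ++ \<tau>) = cyl \<sigma> \<inter> cyl \<tau>"
  by (auto simp: cyl_def extends_add)

lemma marginal_extension:
  assumes "finite T" "T \<subseteq> verts S" "dom \<rho> \<inter> T = {}" "dom \<rho> \<subseteq> verts S"
  shows "marginal \<mu> \<rho> = (\<Sum>\<tau>\<in>configs S T. marginal \<mu> (\<rho> ++ \<tau>))"
proof -
  have "marginal \<mu> \<rho> = (\<Sum>\<tau>\<in>configs S T. measure \<mu> (cyl \<rho> \<inter> cyl \<tau>))"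
    unfolding marginal_cyl by (rule total_probability) (use assms cyl_sets in auto)
  also have "\<dots> = (\<Sum>\<tau>\<in>configs S T. marginal \<mu> (\<rho> ++ \<tau>))"
  proof (rule sum.cong[OF refl])
    fix \<tau> assume "\<tau> \<in> configs S T"
    then have "dom \<rho> \<inter> dom \<tau> = {}" using assms configs_dom by blast
    then show "measure \<mu> (cyl \<rho> \<inter> cyl \<tau>) = marginal \<mu> (\<rho> ++ \<tau>)"
      by (simp add: marginal_cyl cyl_add)
  qed
  finally show ?thesis .
qed

text \<open>Joint instead of conditional probabilities: a boundary condition of probability 0 is
  then covered by \<open>c = 0\<close>, and sums over all boundary conditions need no case
  distinction.\<close>

lemma gibbs_joint:
  assumes "finite W" "W \<subseteq> verts S" "\<xi> \<in> configs S (boundary S W)"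
  shows "\<exists>c. \<forall>\<eta>\<in>configs S W. marginal \<mu> (\<eta> ++ \<xi>) = c * weight S W (\<eta> ++ \<xi>)"
proof (cases "marginal \<mu> \<xi> > 0")
  case True
  then obtain c where c: "\<And>\<eta>. \<eta> \<in> configs S W \<Longrightarrow>
      \<P>(\<omega> in \<mu>. extends \<omega> \<eta> \<bar> extends \<omega> \<xi>) = c * weight S W (\<eta> ++ \<xi>)"
    using gibbs assms unfolding gibbs_measure_def by meson
  have "marginal \<mu> (\<eta> ++ \<xi>) = (c * marginal \<mu> \<xi>) * weight S W (\<eta> ++ \<xi>)" if "\<eta> \<in> configs S W" for \<eta>
  proof -
    have "dom \<eta> \<inter> dom \<xi> = {}"
      using that assms(3) boundary_verts(2)[of W] configs_dom by blast
    then have "marginal \<mu> (\<eta> ++ \<xi>) = \<P>(\<omega> in \<mu>. extends \<omega> \<eta> \<bar> extends \<omega> \<xi>) * marginal \<mu> \<xi>"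
      using True by (simp add: cond_prob_def marginal_def extends_add)
    then show ?thesis using c[OF that] by simp
  qed
  then show ?thesis by blast
next
  case False
  have "marginal \<mu> (\<eta> ++ \<xi>) = 0" if "\<eta> \<in> configs S W" for \<eta>
  proof -
    have d: "dom \<eta> \<inter> dom \<xi> = {}"
      using that assms(3) boundary_verts(2)[of W] configs_dom by blast
    have "measure \<mu> (cyl (\<eta> ++ \<xi>)) \<le> measure \<mu> (cyl \<xi>)"
      by (rule finite_measure_mono) (use boundary_verts(1)[of W] configs_dom[OF assms(3)] in
          \<open>simp_all add: cyl_add[OF d] cyl_sets\<close>)
    then show ?thesis
      using False measure_nonneg[of \<mu> "cyl (\<eta> ++ \<xi>)"] unfolding marginal_cyl by linarith
  qed
  then show ?thesis by (intro exI[of _ 0]) simp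
qed

text \<open>The Gibbs property needs the whole boundary of a region to be fixed, so it is applied to
  \<open>B \<union> U\<close> and summed over the spins \<open>\<xi>\<close> on the boundary of that
  set. As \<open>U\<close> shields \<open>B\<close>, each summand is the weight on \<open>B\<close>
  times a factor free of \<open>\<zeta>\<close>; the sum of these factors is
  \<open>K\<close>.\<close>

lemma outer_factor:
  assumes B: "finite B" "B \<subseteq> verts S" and U: "finite U" "U \<subseteq> verts S" "U \<inter> B = {}"
    "boundary S B \<subseteq> U" and \<kappa>: "\<kappa> \<in> configs S U"
  shows "\<exists>K. \<forall>\<zeta>\<in>configs S B. marginal \<mu> (\<zeta> ++ \<kappa>) = K * weight S B (\<zeta> ++ \<kappa>)"
proof -
  define W where "W = B \<union> U"
  have W: "finite W" "W \<subseteq> verts S" "B \<subseteq> W" using B U by (auto simp: W_def)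
  define R where "R \<xi> = (\<Prod>w\<in>W - B. spin_field S (the ((\<kappa> ++ \<xi>) w))) *
      (\<Prod>e\<in>{e \<in> edges S. e \<inter> W \<noteq> {} \<and> e \<inter> B = {}}. edge_weight S (\<kappa> ++ \<xi>) e)" for \<xi>
  have "\<forall>\<xi>\<in>configs S (boundary S W). \<exists>c. \<forall>\<eta>\<in>configs S W. marginal \<mu> (\<eta> ++ \<xi>) = c * weight S W (\<eta> ++ \<xi>)"
    using gibbs_joint[OF W(1,2)] by blast
  then obtain c where c: "\<And>\<xi> \<eta>. \<xi> \<in> configs S (boundary S W) \<Longrightarrow> \<eta> \<in> configs S W \<Longrightarrow>
      marginal \<mu> (\<eta> ++ \<xi>) = c \<xi> * weight S W (\<eta> ++ \<xi>)" by metis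
  have main: "marginal \<mu> (\<zeta> ++ \<kappa>) = (\<Sum>\<xi>\<in>configs S (boundary S W). c \<xi> * R \<xi>) * weight S B (\<zeta> ++ \<kappa>)"
    if \<zeta>: "\<zeta> \<in> configs S B" for \<zeta>
  proof -
    have \<eta>: "\<zeta> ++ \<kappa> \<in> configs S W" unfolding W_def by (rule configs_add[OF \<zeta> \<kappa>])
    have "marginal \<mu> (\<zeta> ++ \<kappa>) = (\<Sum>\<xi>\<in>configs S (boundary S W). marginal \<mu> (\<zeta> ++ \<kappa> ++ \<xi>))"
      by (rule marginal_extension)
        (use finite_boundary[OF W(1,2)] boundary_verts[of W] W(2) configs_dom[OF \<eta>] in auto)
    also have "\<dots> = (\<Sum>\<xi>\<in>configs S (boundary S W). c \<xi> * R \<xi> * weight S B (\<zeta> ++ \<kappa>))"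
    proof (rule sum.cong[OF refl])
      fix \<xi> assume \<xi>: "\<xi> \<in> configs S (boundary S W)"
      have off: "(\<zeta> ++ \<kappa> ++ \<xi>) x = (\<kappa> ++ \<xi>) x" if "x \<notin> B" for x
        using that configs_dom[OF \<zeta>] by (auto simp: map_add_def domIff split: option.splits)
      have on: "(\<zeta> ++ \<kappa> ++ \<xi>) x = (\<zeta> ++ \<kappa>) x" if "x \<in> W" for x
      proof -
        have "\<xi> x = None" using that configs_dom[OF \<xi>] boundary_verts(2)[of W] by (auto simp: domIff)
        then show ?thesis by (simp add: map_add_def)
      qed
      have "marginal \<mu> (\<zeta> ++ \<kappa> ++ \<xi>) = c \<xi> * weight S W (\<zeta> ++ \<kappa> ++ \<xi>)" by (rule c[OF \<xi> \<eta>])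
      also have "weight S W (\<zeta> ++ \<kappa> ++ \<xi>) = weight S B (\<zeta> ++ \<kappa> ++ \<xi>) *
         ((\<Prod>w\<in>W - B. spin_field S (the ((\<zeta> ++ \<kappa> ++ \<xi>) w))) *
          (\<Prod>e\<in>{e \<in> edges S. e \<inter> W \<noteq> {} \<and> e \<inter> B = {}}. edge_weight S (\<zeta> ++ \<kappa> ++ \<xi>) e))"
        by (rule weight_factor[OF W])
      also have "(\<Prod>w\<in>W - B. spin_field S (the ((\<zeta> ++ \<kappa> ++ \<xi>) w))) =
          (\<Prod>w\<in>W - B. spin_field S (the ((\<kappa> ++ \<xi>) w)))"
        by (rule prod.cong) (auto simp: off)
      also have "(\<Prod>e\<in>{e \<in> edges S. e \<inter> W \<noteq> {} \<and> e \<inter> B = {}}. edge_weight S (\<zeta> ++ \<kappa> ++ \<xi>) e) =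
          (\<Prod>e\<in>{e \<in> edges S. e \<inter> W \<noteq> {} \<and> e \<inter> B = {}}. edge_weight S (\<kappa> ++ \<xi>) e)"
        by (intro prod.cong edge_weight_cong off) auto
      also have "weight S B (\<zeta> ++ \<kappa> ++ \<xi>) = weight S B (\<zeta> ++ \<kappa>)"
        by (rule weight_cong, rule on) (use U in \<open>auto simp: W_def\<close>)
      finally show "marginal \<mu> (\<zeta> ++ \<kappa> ++ \<xi>) = c \<xi> * R \<xi> * weight S B (\<zeta> ++ \<kappa>)"
        by (simp add: R_def)
    qed
    finally show ?thesis by (simp add: sum_distrib_right)
  qed
  then show ?thesis by blast
qed

text \<open>The elementary counterpart of \<open>cond_marginal\<close>, with no limit involved. It
  is 0 if the condition has probability 0, so positivity has to be supplied alongside.\<close>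

definition cond_at :: "'v config \<Rightarrow> 'v \<Rightarrow> nat \<Rightarrow> real" where
  "cond_at \<rho> v i = \<P>(\<omega> in \<mu>. \<omega> v = i \<bar> extends \<omega> \<rho>)"

lemma cond_at_cyl:
  "cond_at \<rho> v i = measure \<mu> ({\<omega> \<in> space \<mu>. \<omega> v = i} \<inter> cyl \<rho>) / measure \<mu> (cyl \<rho>)"
proof -
  have "{\<omega> \<in> space \<mu>. \<omega> v = i \<and> extends \<omega> \<rho>} = {\<omega> \<in> space \<mu>. \<omega> v = i} \<inter> cyl \<rho>"
    by (auto simp: cyl_def)
  then show ?thesis by (simp add: cond_at_def cond_prob_def cyl_def)
qed

lemma spin_event: "v \<in> verts S \<Longrightarrow> {\<omega> \<in> space \<mu>. \<omega> v = i} \<in> sets \<mu>"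
  using cyl_sets[of "[v \<mapsto> i]"] by (simp add: cyl_def extends_iff eq_commute)

text \<open>The configurations on \<open>B\<close> have, by the factorisation above, the same weights given all of \<open>\<rho>\<close>
  outside \<open>B\<close> as given only \<open>\<rho>\<close> on the boundary; hence the two conditional laws are proportional.\<close>

lemma markov_property:
  assumes B: "finite B" "B \<subseteq> verts S" and v: "v \<in> B"
    and \<rho>: "finite (dom \<rho>)" "\<rho> \<in> configs S (dom \<rho>)" "dom \<rho> \<subseteq> verts S"
    and bd: "boundary S B \<subseteq> dom \<rho>" and pos: "marginal \<mu> \<rho> > 0"
  shows "cond_at \<rho> v i = cond_at (\<rho> |` (B \<union> boundary S B)) v i"
proof -
  define \<beta> where "\<beta> = \<rho> |` B"
  define \<kappa> where "\<kappa> = \<rho> |` (dom \<rho> - B)"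
  define \<gamma> where "\<gamma> = \<rho> |` boundary S B"
  have bB: "boundary S B \<inter> B = {}" by (rule boundary_verts(2))
  have \<kappa>: "\<kappa> \<in> configs S (dom \<rho> - B)"
    using configs_restrict[OF \<rho>(2), of "dom \<rho> - B"] by (simp add: \<kappa>_def Int_absorb1)
  have \<gamma>: "\<gamma> \<in> configs S (boundary S B)"
    using configs_restrict[OF \<rho>(2), of "boundary S B"] bd by (simp add: \<gamma>_def Int_absorb1)
  have \<beta>: "\<beta> \<in> configs S (dom \<rho> \<inter> B)"
    using configs_restrict[OF \<rho>(2), of "B"] by (simp add: \<beta>_def)
  obtain K where K: "\<And>\<zeta>. \<zeta> \<in> configs S B \<Longrightarrow> marginal \<mu> (\<zeta> ++ \<kappa>) = K * weight S B (\<zeta> ++ \<kappa>)"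
  proof -
    have "finite (dom \<rho> - B)" "dom \<rho> - B \<subseteq> verts S" "(dom \<rho> - B) \<inter> B = {}"
      "boundary S B \<subseteq> dom \<rho> - B"
      using \<rho> bd bB by auto
    from outer_factor[OF B this \<kappa>] show ?thesis using that by blast
  qed
  obtain C where C: "\<And>\<zeta>. \<zeta> \<in> configs S B \<Longrightarrow> marginal \<mu> (\<zeta> ++ \<gamma>) = C * weight S B (\<zeta> ++ \<gamma>)"
    using outer_factor[OF B finite_boundary[OF B] boundary_verts(1) bB subset_refl \<gamma>] by blast
  have wt: "weight S B (\<zeta> ++ \<kappa>) = weight S B (\<zeta> ++ \<gamma>)" if \<zeta>: "\<zeta> \<in> configs S B" for \<zeta>
  proof (rule weight_cong)
    fix x assume "x \<in> B \<union> boundary S B"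
    then have "\<kappa> x = \<gamma> x" using bB bd by (auto simp: \<kappa>_def \<gamma>_def restrict_map_def)
    then show "(\<zeta> ++ \<kappa>) x = (\<zeta> ++ \<gamma>) x" by (simp add: map_add_def)
  qed
  \<comment> \<open>\<open>\<rho>\<close> may also fix spins inside \<open>B\<close>, collected in
    \<open>\<beta>\<close>, so only those \<open>\<zeta>\<close> that extend \<open>\<beta>\<close>
    contribute. The event is left general because both numerator and denominator of the conditional
    probability are needed.\<close>
  have expand: "measure \<mu> (A \<inter> cyl (\<beta> ++ \<theta>)) = (\<Sum>\<zeta>\<in>{\<zeta> \<in> configs S B. P \<zeta> \<and> \<beta> \<subseteq>\<^sub>m \<zeta>}. marginal \<mu> (\<zeta> ++ \<theta>))"
    if A: "A \<in> sets \<mu>" and P: "\<And>\<zeta> \<omega>. \<zeta> \<in> configs S B \<Longrightarrow> \<omega> \<in> cyl \<zeta> \<Longrightarrow> \<omega> \<in> A \<longleftrightarrow> P \<zeta>"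
      and \<theta>: "dom \<theta> \<inter> B = {}" "dom \<theta> \<subseteq> verts S" for A \<theta> P
  proof -
    have dis: "dom \<beta> \<inter> dom \<theta> = {}" using configs_dom[OF \<beta>] \<theta> by auto
    have sub: "dom (\<beta> ++ \<theta>) \<subseteq> verts S" using configs_dom[OF \<beta>] \<theta> \<rho>(3) by auto
    have "measure \<mu> (A \<inter> cyl (\<beta> ++ \<theta>)) = (\<Sum>\<zeta>\<in>configs S B. measure \<mu> (A \<inter> cyl (\<beta> ++ \<theta>) \<inter> cyl \<zeta>))"
      by (rule total_probability) (use B A cyl_sets[OF sub] in auto)
    also have "\<dots> = (\<Sum>\<zeta>\<in>configs S B. if P \<zeta> \<and> \<beta> \<subseteq>\<^sub>m \<zeta> then marginal \<mu> (\<zeta> ++ \<theta>) else 0)"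
    proof (rule sum.cong[OF refl])
      fix \<zeta> assume \<zeta>: "\<zeta> \<in> configs S B"
      have d: "dom \<zeta> \<inter> dom \<theta> = {}" using configs_dom[OF \<zeta>] \<theta> by auto
      have "A \<inter> cyl (\<beta> ++ \<theta>) \<inter> cyl \<zeta> = (if P \<zeta> \<and> \<beta> \<subseteq>\<^sub>m \<zeta> then cyl (\<zeta> ++ \<theta>) else {})"
      proof (cases "P \<zeta> \<and> \<beta> \<subseteq>\<^sub>m \<zeta>")
        case True
        have "extends \<omega> \<beta>" if "extends \<omega> \<zeta>" for \<omega>
          using True that by (metis extends_def map_le_trans)
        then have "cyl \<zeta> \<subseteq> cyl \<beta>" by (auto simp: cyl_def)
        moreover have "cyl \<zeta> \<subseteq> A" using P[OF \<zeta>] True by blast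
        ultimately show ?thesis using True by (auto simp: cyl_add[OF d] cyl_add[OF dis])
      next
        case False
        have "\<beta> \<subseteq>\<^sub>m \<zeta>" if "\<omega> \<in> cyl \<beta>" "\<omega> \<in> cyl \<zeta>" for \<omega>
        proof (unfold map_le_def, intro ballI)
          fix a assume a: "a \<in> dom \<beta>"
          then have "a \<in> dom \<zeta>" using configs_dom[OF \<beta>] configs_dom[OF \<zeta>] by auto
          then show "\<beta> a = \<zeta> a" using that a by (auto simp: cyl_def extends_iff)
        qed
        then show ?thesis using False P[OF \<zeta>] by (auto simp: cyl_add[OF dis])
      qed
      then show "measure \<mu> (A \<inter> cyl (\<beta> ++ \<theta>) \<inter> cyl \<zeta>) =
          (if P \<zeta> \<and> \<beta> \<subseteq>\<^sub>m \<zeta> then marginal \<mu> (\<zeta> ++ \<theta>) else 0)"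
        by (simp add: marginal_cyl)
    qed
    also have "\<dots> = (\<Sum>\<zeta>\<in>{\<zeta> \<in> configs S B. P \<zeta> \<and> \<beta> \<subseteq>\<^sub>m \<zeta>}. marginal \<mu> (\<zeta> ++ \<theta>))"
      by (simp add: sum.inter_filter finite_configs B)
    finally show ?thesis .
  qed
  have d\<kappa>: "dom \<kappa> \<inter> B = {}" "dom \<kappa> \<subseteq> verts S" using configs_dom[OF \<kappa>] \<rho>(3) by auto
  have d\<gamma>: "dom \<gamma> \<inter> B = {}" "dom \<gamma> \<subseteq> verts S"
    using configs_dom[OF \<gamma>] boundary_verts[of B] by auto
  \<comment> \<open>Cross-multiplied, since neither \<open>C\<close> nor \<open>K\<close> is known
    to be nonzero yet.\<close>
  have proportional: "C * measure \<mu> (A \<inter> cyl (\<beta> ++ \<kappa>)) = K * measure \<mu> (A \<inter> cyl (\<beta> ++ \<gamma>))"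
    if A: "A \<in> sets \<mu>" and P: "\<And>\<zeta> \<omega>. \<zeta> \<in> configs S B \<Longrightarrow> \<omega> \<in> cyl \<zeta> \<Longrightarrow> \<omega> \<in> A \<longleftrightarrow> P \<zeta>" for A P
  proof -
    let ?Q = "{\<zeta> \<in> configs S B. P \<zeta> \<and> \<beta> \<subseteq>\<^sub>m \<zeta>}"
    have "measure \<mu> (A \<inter> cyl (\<beta> ++ \<kappa>)) = (\<Sum>\<zeta>\<in>?Q. marginal \<mu> (\<zeta> ++ \<kappa>))"
      using A P d\<kappa> by (rule expand)
    also have "\<dots> = (\<Sum>\<zeta>\<in>?Q. K * weight S B (\<zeta> ++ \<gamma>))"
      by (rule sum.cong) (auto simp: K wt)
    finally have \<kappa>_eq: "measure \<mu> (A \<inter> cyl (\<beta> ++ \<kappa>)) = (\<Sum>\<zeta>\<in>?Q. K * weight S B (\<zeta> ++ \<gamma>))" .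
    have "measure \<mu> (A \<inter> cyl (\<beta> ++ \<gamma>)) = (\<Sum>\<zeta>\<in>?Q. marginal \<mu> (\<zeta> ++ \<gamma>))"
      using A P d\<gamma> by (rule expand)
    also have "\<dots> = (\<Sum>\<zeta>\<in>?Q. C * weight S B (\<zeta> ++ \<gamma>))"
      by (rule sum.cong) (auto simp: C)
    finally show ?thesis unfolding \<kappa>_eq by (simp add: sum_distrib_left mult.left_commute)
  qed
  have \<rho>1: "\<beta> ++ \<kappa> = \<rho>" unfolding \<beta>_def \<kappa>_def by (rule restrict_split) auto
  have \<rho>2: "\<beta> ++ \<gamma> = \<rho> |` (B \<union> boundary S B)"
  proof
    fix x show "(\<beta> ++ \<gamma>) x = (\<rho> |` (B \<union> boundary S B)) x"
      by (cases "x \<in> B"; cases "x \<in> boundary S B"; cases "\<rho> x")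
        (use bB in \<open>auto simp: \<beta>_def \<gamma>_def map_add_def restrict_map_def\<close>)
  qed
  define A where "A = {\<omega> \<in> space \<mu>. \<omega> v = i}"
  have A: "A \<in> sets \<mu>" using spin_event[of v i] v B unfolding A_def by blast
  have AP: "\<omega> \<in> A \<longleftrightarrow> \<zeta> v = Some i" if "\<zeta> \<in> configs S B" "\<omega> \<in> cyl \<zeta>" for \<zeta> \<omega>
    using that configs_dom[OF that(1)] v by (auto simp: A_def cyl_def extends_iff)
  have e1: "C * measure \<mu> (A \<inter> cyl \<rho>) = K * measure \<mu> (A \<inter> cyl (\<rho> |` (B \<union> boundary S B)))"
    using proportional[OF A, of "\<lambda>\<zeta>. \<zeta> v = Some i"] AP by (simp add: \<rho>1 \<rho>2)
  have sp: "space \<mu> \<inter> cyl \<theta> = cyl \<theta>" for \<theta> by (auto simp: cyl_def)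
  have e2: "C * measure \<mu> (cyl \<rho>) = K * measure \<mu> (cyl (\<rho> |` (B \<union> boundary S B)))"
  proof -
    have "C * measure \<mu> (space \<mu> \<inter> cyl (\<beta> ++ \<kappa>)) = K * measure \<mu> (space \<mu> \<inter> cyl (\<beta> ++ \<gamma>))"
      by (rule proportional[OF sets.top, of "\<lambda>_. True"]) (auto simp: cyl_def)
    then show ?thesis by (simp add: \<rho>1 \<rho>2 sp)
  qed
  have p1: "measure \<mu> (cyl \<rho>) > 0" using pos by (simp add: marginal_cyl)
  have p2: "measure \<mu> (cyl (\<rho> |` (B \<union> boundary S B))) > 0"
    using marginal_restrict_mono[OF gibbs countable_verts \<rho>(3), of "B \<union> boundary S B"] pos by (simp add: marginal_cyl)
  \<comment> \<open>With \<open>C = 0\<close> every summand would vanish, although the restricted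
    cylinder contains that of \<open>\<rho>\<close> and has positive probability.\<close>
  have "C \<noteq> 0"
  proof
    assume C0: "C = 0"
    have "measure \<mu> (space \<mu> \<inter> cyl (\<beta> ++ \<gamma>)) =
        (\<Sum>\<zeta>\<in>{\<zeta> \<in> configs S B. True \<and> \<beta> \<subseteq>\<^sub>m \<zeta>}. marginal \<mu> (\<zeta> ++ \<gamma>))"
      by (rule expand[OF sets.top _ d\<gamma>]) (auto simp: cyl_def)
    also have "\<dots> = 0" by (rule sum.neutral) (auto simp: C C0)
    finally show False using p2 by (simp add: \<rho>2 sp)
  qed
  have "C * x / (C * y) = x / y" for x y :: real using \<open>C \<noteq> 0\<close> by simp
  then have "cond_at \<rho> v i = (C * measure \<mu> (A \<inter> cyl \<rho>)) / (C * measure \<mu> (cyl \<rho>))"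
    by (simp add: cond_at_cyl A_def)
  also have "\<dots> = (K * measure \<mu> (A \<inter> cyl (\<rho> |` (B \<union> boundary S B)))) /
      (K * measure \<mu> (cyl (\<rho> |` (B \<union> boundary S B))))"
    by (simp only: e1 e2)
  also have "K \<noteq> 0" using e2 p1 \<open>C \<noteq> 0\<close> by auto
  then have "(K * measure \<mu> (A \<inter> cyl (\<rho> |` (B \<union> boundary S B)))) /
      (K * measure \<mu> (cyl (\<rho> |` (B \<union> boundary S B)))) = cond_at (\<rho> |` (B \<union> boundary S B)) v i"
    by (simp add: cond_at_cyl A_def)
  finally show ?thesis .
qed

end


section \<open>Consequences of strong spatial mixing\<close>

context gibbs_system
begin

lemma cond_at_nonneg: "0 \<le> cond_at \<rho> v i"
  by (simp add: cond_at_cyl)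

lemma sum_cond_at:
  assumes "dom \<rho> \<subseteq> verts S" "marginal \<mu> \<rho> > 0" "v \<in> verts S"
  shows "(\<Sum>i\<in>spins S. cond_at \<rho> v i) = 1"
proof -
  have conf: "configs S {v} = (\<lambda>i. [v \<mapsto> i]) ` spins S"
  proof
    show "configs S {v} \<subseteq> (\<lambda>i. [v \<mapsto> i]) ` spins S"
    proof
      fix \<tau> assume \<tau>: "\<tau> \<in> configs S {v}"
      obtain i where i: "i \<in> spins S" "\<tau> v = Some i"
        using configs_some[OF \<tau> singletonI] by (rule bexE)
      have "\<tau> = [v \<mapsto> i]"
      proof
        fix x show "\<tau> x = [v \<mapsto> i] x"
        proof (cases "x = v")
          case False
          then have "x \<notin> dom \<tau>" using configs_dom[OF \<tau>] by simp
          then show ?thesis using False by (simp add: domIff)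
        qed (simp add: i)
      qed
      then show "\<tau> \<in> (\<lambda>i. [v \<mapsto> i]) ` spins S" using i by blast
    qed
    show "(\<lambda>i. [v \<mapsto> i]) ` spins S \<subseteq> configs S {v}"
    proof
      fix \<tau> assume "\<tau> \<in> (\<lambda>i. [v \<mapsto> i]) ` spins S"
      then obtain i where "i \<in> spins S" "\<tau> = [v \<mapsto> i]" by blast
      then show "\<tau> \<in> configs S {v}" unfolding configs_iff by simp
    qed
  qed
  have inj: "inj_on (\<lambda>i. [v \<mapsto> i]) (spins S)"
    by (rule inj_onI) (drule fun_cong[of _ _ v], simp)
  have cyl: "cyl [v \<mapsto> i] = {\<omega> \<in> space \<mu>. \<omega> v = i}" for i
    by (auto simp: cyl_def extends_alt)
  have "measure \<mu> (cyl \<rho>) = (\<Sum>\<tau>\<in>configs S {v}. measure \<mu> (cyl \<rho> \<inter> cyl \<tau>))"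
    by (rule total_probability) (use assms cyl_sets in auto)
  also have "\<dots> = (\<Sum>i\<in>spins S. measure \<mu> ({\<omega> \<in> space \<mu>. \<omega> v = i} \<inter> cyl \<rho>))"
    unfolding conf sum.reindex[OF inj] by (simp add: cyl Int_commute)
  finally show ?thesis
    using assms(2) by (simp add: cond_at_cyl marginal_cyl flip: sum_divide_distrib)
qed

lemma cond_marginal_local:
  assumes B: "finite B" "B \<subseteq> verts S" "v \<in> B" and bd: "boundary S B \<subseteq> dom \<rho>"
    and \<rho>: "dom \<rho> \<subseteq> verts S" "\<rho> \<in> configs S (dom \<rho>)" "feasible \<mu> \<rho>"
  shows "cond_marginal \<mu> \<rho> v i = cond_at (\<rho> |` (B \<union> boundary S B)) v i"
    and "marginal \<mu> (\<rho> |` (B \<union> boundary S B)) > 0"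
proof -
  define F where "F = B \<union> boundary S B"
  have F: "finite F" using B finite_boundary by (simp add: F_def)
  have eq: "\<P>(\<omega> in \<mu>. \<omega> v = i \<bar> extends \<omega> (\<rho> |` U)) = cond_at (\<rho> |` F) v i"
    if U: "finite U" "U \<subseteq> dom \<rho>" "dom \<rho> \<inter> F \<subseteq> U" for U
  proof -
    have d: "dom (\<rho> |` U) = U" using U by auto
    have "cond_at (\<rho> |` U) v i = cond_at ((\<rho> |` U) |` (B \<union> boundary S B)) v i"
    proof (rule markov_property[OF B])
      show "\<rho> |` U \<in> configs S (dom (\<rho> |` U))"
        using configs_restrict[OF \<rho>(2), of U] U(2) d by (simp add: Int_absorb1)
      show "marginal \<mu> (\<rho> |` U) > 0" using \<rho>(3) U by (simp add: feasible_def)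
      show "boundary S B \<subseteq> dom (\<rho> |` U)" unfolding d using bd U(3) by (auto simp: F_def)
    qed (use U \<rho>(1) d in auto)
    also have "(\<rho> |` U) |` (B \<union> boundary S B) = \<rho> |` F"
    proof
      fix x
      have "\<rho> x = None" if "x \<in> F" "x \<notin> U"
        using that U(3) by (metis IntI domIff subsetD)
      then show "(\<rho> |` U |` (B \<union> boundary S B)) x = (\<rho> |` F) x"
        unfolding F_def by (simp add: restrict_map_def)
    qed
    finally show ?thesis by (simp add: cond_at_def)
  qed
  have "\<forall>\<^sub>F U in finite_subsets_at_top (dom \<rho>).
      \<P>(\<omega> in \<mu>. \<omega> v = i \<bar> extends \<omega> (\<rho> |` U)) = cond_at (\<rho> |` F) v i"
    unfolding eventually_finite_subsets_at_top
    by (intro exI[of _ "dom \<rho> \<inter> F"]) (use F eq in auto)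
  then show "cond_marginal \<mu> \<rho> v i = cond_at (\<rho> |` (B \<union> boundary S B)) v i"
    unfolding cond_marginal_def F_def[symmetric]
    by (intro tendsto_Lim tendsto_eventually) simp_all
  have "marginal \<mu> (\<rho> |` (dom \<rho> \<inter> F)) > 0" using \<rho>(3) F by (simp add: feasible_def)
  then show "marginal \<mu> (\<rho> |` (B \<union> boundary S B)) > 0"
    by (simp add: restrict_Int_dom F_def)
qed

text \<open>Over each finite \<open>U\<close> there are finitely many cylinders, and those of
  probability 0 are almost surely avoided. A countable vertex set has only countably many finite
  subsets, so the exceptional sets add up to a null set.\<close>

lemma AE_restrictions_pos:
  "AE \<omega> in \<mu>. \<forall>U\<in>{U. finite U \<and> U \<subseteq> verts S}. marginal \<mu> ((\<lambda>w. Some (\<omega> w)) |` U) > 0"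
proof -
  have "AE \<omega> in \<mu>. marginal \<mu> ((\<lambda>w. Some (\<omega> w)) |` U) > 0" if U: "finite U" "U \<subseteq> verts S" for U
  proof -
    have "AE \<omega> in \<mu>. \<forall>\<tau>\<in>configs S U. marginal \<mu> \<tau> = 0 \<longrightarrow> \<omega> \<notin> cyl \<tau>"
    proof (rule AE_finite_allI[OF finite_configs[OF U(1)]])
      fix \<tau> assume "\<tau> \<in> configs S U"
      then have "cyl \<tau> \<in> sets \<mu>" using U configs_dom by (intro cyl_sets) blast
      then show "AE \<omega> in \<mu>. marginal \<mu> \<tau> = 0 \<longrightarrow> \<omega> \<notin> cyl \<tau>"
        by (cases "marginal \<mu> \<tau> = 0") (simp_all add: marginal_cyl prob_eq_0)
    qed
    with AE_space show ?thesis
    proof eventually_elim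
      case (elim \<omega>)
      have "(\<lambda>w. Some (\<omega> w)) |` U \<in> configs S U"
        by (rule restrict_point_config[OF elim(1) U(2)])
      moreover have "\<omega> \<in> cyl ((\<lambda>w. Some (\<omega> w)) |` U)"
        using elim(1) by (auto simp: cyl_def extends_iff)
      ultimately have "marginal \<mu> ((\<lambda>w. Some (\<omega> w)) |` U) \<noteq> 0" using elim(2) by blast
      then show ?case
        unfolding marginal_cyl using measure_nonneg less_eq_real_def by metis
    qed
  qed
  then show ?thesis
    using countable_Collect_finite_subset[OF countable_verts]
    by (subst AE_ball_countable) auto
qed

text \<open>On an infinite \<open>W\<close> every single configuration may have probability 0. But
  the event of \<open>\<rho>\<close> is not null, hence contains a sample point that avoids all null
  cylinders, and the restriction of this point to \<open>W\<close> is feasible.\<close>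

lemma feasible_extension:
  assumes \<rho>: "dom \<rho> \<subseteq> verts S" "marginal \<mu> \<rho> > 0" and W: "W \<subseteq> verts S"
  obtains \<tau> where "\<tau> \<in> configs S W" "feasible \<mu> \<tau>" "\<And>w. w \<in> W \<inter> dom \<rho> \<Longrightarrow> \<tau> w = \<rho> w"
proof -
  have "\<exists>\<omega>\<in>cyl \<rho>. \<forall>U\<in>{U. finite U \<and> U \<subseteq> verts S}. marginal \<mu> ((\<lambda>w. Some (\<omega> w)) |` U) > 0"
  proof (rule ccontr)
    assume no: "\<not> ?thesis"
    have "AE \<omega> in \<mu>. \<omega> \<notin> cyl \<rho>"
      using AE_restrictions_pos by eventually_elim (use no in blast)
    then have "measure \<mu> (cyl \<rho>) = 0" using prob_eq_0[OF cyl_sets[OF \<rho>(1)]] by blast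
    then show False using \<rho>(2) by (simp add: marginal_cyl)
  qed
  then obtain \<omega> where \<omega>: "\<omega> \<in> cyl \<rho>"
    "\<And>U. finite U \<Longrightarrow> U \<subseteq> verts S \<Longrightarrow> marginal \<mu> ((\<lambda>w. Some (\<omega> w)) |` U) > 0" by blast
  define \<tau> where "\<tau> = (\<lambda>w. Some (\<omega> w)) |` W"
  have sp: "\<omega> \<in> space \<mu>" using \<omega>(1) by (simp add: cyl_def)
  show ?thesis
  proof
    show "\<tau> \<in> configs S W" unfolding \<tau>_def by (rule restrict_point_config[OF sp W])
    show "feasible \<mu> \<tau>" unfolding feasible_def
    proof (intro allI impI)
      fix U assume U: "finite U \<and> U \<subseteq> dom \<tau>"
      then have UW: "U \<subseteq> W" by (auto simp: \<tau>_def)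
      then have "\<tau> |` U = (\<lambda>w. Some (\<omega> w)) |` U"
        unfolding \<tau>_def by (simp add: Int_absorb1)
      then show "marginal \<mu> (\<tau> |` U) > 0" using \<omega>(2)[of U] U UW W by auto
    qed
    show "\<tau> w = \<rho> w" if "w \<in> W \<inter> dom \<rho>" for w
      using that \<omega>(1) by (simp add: \<tau>_def cyl_def extends_iff)
  qed
qed

lemma finite_gsphere: "v \<in> verts S \<Longrightarrow> finite (gsphere S v l)"
  using finite_gball[of v "Suc l"] by (rule rev_finite_subset) (auto simp: gsphere_def gball_def)

lemma gsphere_verts: "gsphere S v l \<subseteq> verts S"
  by (auto simp: gsphere_def)

text \<open>The invariant of a run. It asks for positive probability rather than feasibility,
  because then the marginals are elementary conditional probabilities even on an infinite
  domain.\<close>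

definition good :: "'v config \<Rightarrow> bool" where
  "good \<sigma> \<longleftrightarrow> dom \<sigma> \<subseteq> verts S \<and> \<sigma> \<in> configs S (dom \<sigma>) \<and> marginal \<mu> \<sigma> > 0"

lemma goodD: "good \<sigma> \<Longrightarrow> dom \<sigma> \<subseteq> verts S" "good \<sigma> \<Longrightarrow> \<sigma> \<in> configs S (dom \<sigma>)" "good \<sigma> \<Longrightarrow> marginal \<mu> \<sigma> > 0"
  by (auto simp: good_def)

text \<open>Here \<open>\<rho>\<close> is the larger configuration against which the spin was drawn;
  all of it but \<open>\<sigma>\<close> is discarded. A positive marginal given
  \<open>\<rho>\<close> makes the joint event positive, and that event lies in the cylinder of the
  updated configuration.\<close>

lemma good_upd:
  assumes \<sigma>: "good \<sigma>" "v \<in> verts S" "v \<notin> dom \<sigma>" "i \<in> spins S"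
    and \<rho>: "\<sigma> \<subseteq>\<^sub>m \<rho>" "dom \<rho> \<subseteq> verts S" "marginal \<mu> \<rho> > 0" "cond_marginal \<mu> \<rho> v i > 0"
  shows "good (\<sigma>(v \<mapsto> i))"
proof -
  have "cond_at \<rho> v i > 0"
    using \<rho>(4) cond_marginal_pos[OF gibbs countable_verts \<rho>(2,3) \<sigma>(2)] by (simp add: cond_at_def)
  then have "0 < measure \<mu> ({\<omega> \<in> space \<mu>. \<omega> v = i} \<inter> cyl \<rho>)"
    unfolding cond_at_cyl by (simp add: zero_less_divide_iff)
  also have "\<dots> \<le> measure \<mu> (cyl (\<sigma>(v \<mapsto> i)))"
  proof (rule finite_measure_mono)
    have "extends \<omega> \<sigma>" if "extends \<omega> \<rho>" for \<omega>
      using that \<rho>(1) by (metis extends_def map_le_trans)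
    then show "{\<omega> \<in> space \<mu>. \<omega> v = i} \<inter> cyl \<rho> \<subseteq> cyl (\<sigma>(v \<mapsto> i))"
      by (auto simp: cyl_def extends_upd[OF \<sigma>(3)])
    show "cyl (\<sigma>(v \<mapsto> i)) \<in> sets \<mu>"
      by (rule cyl_sets) (use \<sigma>(2) goodD(1)[OF \<sigma>(1)] in auto)
  qed
  finally show ?thesis
    using \<sigma>(2,4) goodD(1)[OF \<sigma>(1)] configs_upd[OF goodD(2)[OF \<sigma>(1)], of i v]
    unfolding good_def marginal_cyl by auto
qed

end

section \<open>Fillings of the sphere and the threshold\<close>

locale ssm_system = gibbs_system S \<mu>
  for S :: "'v spin_system" and \<mu> :: "('v \<Rightarrow> nat) measure" +
  fixes f :: "nat \<Rightarrow> real" and l :: nat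
  assumes ssm: "strong_spatial_mixing S \<mu> f" and f_nonneg: "0 \<le> f l" and l_pos: "1 \<le> l"
begin

text \<open>The index set of the minimum in \<open>p_low\<close>. For infinite
  \<open>\<sigma>\<close> a filling can be feasible and still have probability 0, so its marginals
  are evaluated by locality instead of positivity.\<close>

definition fillings :: "'v config \<Rightarrow> 'v \<Rightarrow> 'v config set" where
  "fillings \<sigma> v = {\<tau> \<in> configs S (gsphere S v l - dom \<sigma>). feasible \<mu> (\<sigma> ++ \<tau>)}"

lemma finite_fillings: "v \<in> verts S \<Longrightarrow> finite (fillings \<sigma> v)"
  using finite_configs[of "gsphere S v l - dom \<sigma>" S] finite_gsphere by (simp add: fillings_def)

lemma fillingD:
  assumes "good \<sigma>" "\<tau> \<in> fillings \<sigma> v"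
  shows "\<tau> \<in> configs S (gsphere S v l - dom \<sigma>)" "feasible \<mu> (\<sigma> ++ \<tau>)"
    "dom (\<sigma> ++ \<tau>) = dom \<sigma> \<union> gsphere S v l" "dom (\<sigma> ++ \<tau>) \<subseteq> verts S"
    "\<sigma> ++ \<tau> \<in> configs S (dom (\<sigma> ++ \<tau>))"
proof -
  show \<tau>: "\<tau> \<in> configs S (gsphere S v l - dom \<sigma>)" "feasible \<mu> (\<sigma> ++ \<tau>)"
    using assms by (auto simp: fillings_def)
  show d: "dom (\<sigma> ++ \<tau>) = dom \<sigma> \<union> gsphere S v l" using configs_dom[OF \<tau>(1)] by auto
  show "dom (\<sigma> ++ \<tau>) \<subseteq> verts S" unfolding d using goodD(1)[OF assms(1)] gsphere_verts by blast
  show "\<sigma> ++ \<tau> \<in> configs S (dom (\<sigma> ++ \<tau>))"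
    using configs_add[OF goodD(2)[OF assms(1)] \<tau>(1)] d by simp
qed

text \<open>The probability of \<open>\<sigma>\<close> is the sum over its finitely many fillings,
  so some term is positive. In particular the minimum in \<open>p_low\<close> is taken over a
  nonempty set.\<close>

lemma positive_filling:
  assumes "good \<sigma>" "v \<in> verts S"
  obtains \<tau> where "\<tau> \<in> fillings \<sigma> v" "marginal \<mu> (\<sigma> ++ \<tau>) > 0"
proof -
  have "marginal \<mu> \<sigma> = (\<Sum>\<tau>\<in>configs S (gsphere S v l - dom \<sigma>). marginal \<mu> (\<sigma> ++ \<tau>))"
    by (rule marginal_extension)
      (use goodD(1)[OF assms(1)] finite_gsphere[OF assms(2)] gsphere_verts[of v l] in auto)
  then obtain \<tau> where \<tau>: "\<tau> \<in> configs S (gsphere S v l - dom \<sigma>)" "marginal \<mu> (\<sigma> ++ \<tau>) > 0"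
    using goodD(3)[OF assms(1)] by (metis not_less sum_nonpos)
  have "dom (\<sigma> ++ \<tau>) \<subseteq> verts S"
    using configs_dom[OF \<tau>(1)] goodD(1)[OF assms(1)] gsphere_verts[of v l] by auto
  then have "feasible \<mu> (\<sigma> ++ \<tau>)"
    using feasible_if_marginal_pos[OF gibbs countable_verts] \<tau>(2) by blast
  then show ?thesis using that \<tau> by (simp add: fillings_def)
qed

lemma filling_local:
  assumes "good \<sigma>" "v \<in> verts S" "\<tau> \<in> fillings \<sigma> v"
  shows "cond_marginal \<mu> (\<sigma> ++ \<tau>) v i =
      cond_at ((\<sigma> ++ \<tau>) |` (gball v l \<union> boundary S (gball v l))) v i"
    and "marginal \<mu> ((\<sigma> ++ \<tau>) |` (gball v l \<union> boundary S (gball v l))) > 0"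
proof -
  note F = fillingD[OF assms(1,3)]
  have "boundary S (gball v l) \<subseteq> dom (\<sigma> ++ \<tau>)" unfolding F(3) using boundary_gball by blast
  note L = cond_marginal_local[OF finite_gball[OF assms(2)] gball_verts
      center_in_gball[OF assms(2) l_pos] this F(4,5,2)]
  show "cond_marginal \<mu> (\<sigma> ++ \<tau>) v i =
      cond_at ((\<sigma> ++ \<tau>) |` (gball v l \<union> boundary S (gball v l))) v i"
    "marginal \<mu> ((\<sigma> ++ \<tau>) |` (gball v l \<union> boundary S (gball v l))) > 0"
    by (rule L)+
qed

lemma filling_nonneg:
  "good \<sigma> \<Longrightarrow> v \<in> verts S \<Longrightarrow> \<tau> \<in> fillings \<sigma> v \<Longrightarrow> 0 \<le> cond_marginal \<mu> (\<sigma> ++ \<tau>) v i"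
  by (simp add: filling_local(1) cond_at_nonneg)

lemma filling_sum:
  assumes "good \<sigma>" "v \<in> verts S" "\<tau> \<in> fillings \<sigma> v"
  shows "(\<Sum>i\<in>spins S. cond_marginal \<mu> (\<sigma> ++ \<tau>) v i) = 1"
  unfolding filling_local(1)[OF assms]
  by (rule sum_cond_at) (use fillingD(4)[OF assms(1,3)] filling_local(2)[OF assms] assms(2) in auto)

text \<open>Strong spatial mixing only speaks about cofinite domains. Both fillings are extended to the
  complement of the ball around \<open>v\<close>; by locality this does not affect the marginals at \<open>v\<close>, and
  wherever the extensions differ outside the sphere, they do so at a larger distance.\<close>

lemma filling_dist:
  assumes \<sigma>: "good \<sigma>" and v: "v \<in> verts S" "v \<notin> dom \<sigma>"
    and \<tau>: "\<tau>1 \<in> fillings \<sigma> v" "\<tau>2 \<in> fillings \<sigma> v"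
  shows "d_TV S (cond_marginal \<mu> (\<sigma> ++ \<tau>1) v) (cond_marginal \<mu> (\<sigma> ++ \<tau>2) v) \<le> f l"
proof (cases "\<tau>1 = \<tau>2")
  case True
  \<comment> \<open>Strong spatial mixing says nothing about equal configurations; nonnegativity of
    the rate settles this case.\<close>
  then show ?thesis using f_nonneg by (simp add: d_TV_def)
next
  case False
  define B where "B = gball v l"
  \<comment> \<open>The spins that \<open>\<sigma>\<close> has already fixed inside the ball are
    kept, since the marginal at \<open>v\<close> depends on them.\<close>
  define W where "W = verts S - (B - dom \<sigma>)"
  have B: "finite B" "B \<subseteq> verts S" "v \<in> B" "boundary S B \<subseteq> gsphere S v l" "B \<inter> gsphere S v l = {}"
    unfolding B_def by (intro finite_gball gball_verts center_in_gball boundary_gball gball_gsphere v l_pos)+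
  have W: "W \<subseteq> verts S" "gsphere S v l \<subseteq> W" "dom \<sigma> \<subseteq> W"
    using B gsphere_verts[of v l] goodD(1)[OF \<sigma>] by (auto simp: W_def)
  have ext: "\<exists>\<tau>'. \<tau>' \<in> configs S W \<and> feasible \<mu> \<tau>' \<and>
      (\<forall>w\<in>B \<union> gsphere S v l. \<tau>' w = (\<sigma> ++ \<tau>) w) \<and>
      (\<forall>i. cond_marginal \<mu> \<tau>' v i = cond_marginal \<mu> (\<sigma> ++ \<tau>) v i)"
    if \<tau>: "\<tau> \<in> fillings \<sigma> v" for \<tau>
  proof -
    note F = fillingD[OF \<sigma> \<tau>]
    \<comment> \<open>Only this finite part is handed to the extension: feasibility makes it
      positive, and it is all that locality looks at.\<close>
    define U where "U = dom (\<sigma> ++ \<tau>) \<inter> (B \<union> gsphere S v l)"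
    have "finite U" using B finite_gsphere[OF v(1)] by (simp add: U_def)
    then have pos: "marginal \<mu> ((\<sigma> ++ \<tau>) |` U) > 0"
      using F(2) by (simp add: feasible_def U_def)
    have domU: "dom ((\<sigma> ++ \<tau>) |` U) = U" by (auto simp: U_def)
    then have "dom ((\<sigma> ++ \<tau>) |` U) \<subseteq> verts S" using F(4) by (auto simp: U_def)
    then obtain \<tau>' where \<tau>': "\<tau>' \<in> configs S W" "feasible \<mu> \<tau>'"
      "\<And>w. w \<in> W \<inter> U \<Longrightarrow> \<tau>' w = ((\<sigma> ++ \<tau>) |` U) w"
      using feasible_extension[OF _ pos W(1)] domU by metis
    have agree: "\<tau>' w = (\<sigma> ++ \<tau>) w" if w: "w \<in> B \<union> gsphere S v l" for w
    proof (cases "w \<in> dom (\<sigma> ++ \<tau>)")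
      case True
      then have "w \<in> dom \<sigma> \<union> gsphere S v l" unfolding F(3) .
      then have "w \<in> W" using W by blast
      moreover have "w \<in> U" unfolding U_def using True w by blast
      ultimately show ?thesis using \<tau>'(3) by (simp add: restrict_map_def)
    next
      case False
      then have "w \<notin> dom \<sigma>" "w \<notin> gsphere S v l" using F(3) by auto
      then have "w \<notin> W" using w by (auto simp: W_def)
      then have "\<tau>' w = None" using configs_dom[OF \<tau>'(1)] by blast
      then show ?thesis using False by (metis domIff)
    qed
    have W_conf: "dom \<tau>' = W" by (rule configs_dom[OF \<tau>'(1)])
    have "cond_marginal \<mu> \<tau>' v i = cond_at (\<tau>' |` (B \<union> boundary S B)) v i" for i
      by (rule cond_marginal_local(1)[OF B(1-3)]) (use W_conf W B \<tau>' in auto)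
    moreover have "\<tau>' |` (B \<union> boundary S B) = (\<sigma> ++ \<tau>) |` (B \<union> boundary S B)"
      using agree B(4) by (auto simp: restrict_map_def fun_eq_iff)
    ultimately show ?thesis
      using \<tau>' agree filling_local(1)[OF \<sigma> v(1) \<tau>] unfolding B_def by metis
  qed
  obtain \<tau>1' where \<tau>1': "\<tau>1' \<in> configs S W" "feasible \<mu> \<tau>1'"
      "\<And>w. w \<in> B \<union> gsphere S v l \<Longrightarrow> \<tau>1' w = (\<sigma> ++ \<tau>1) w"
      "\<And>i. cond_marginal \<mu> \<tau>1' v i = cond_marginal \<mu> (\<sigma> ++ \<tau>1) v i"
    using ext[OF \<tau>(1)] by blast
  obtain \<tau>2' where \<tau>2': "\<tau>2' \<in> configs S W" "feasible \<mu> \<tau>2'"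
      "\<And>w. w \<in> B \<union> gsphere S v l \<Longrightarrow> \<tau>2' w = (\<sigma> ++ \<tau>2) w"
      "\<And>i. cond_marginal \<mu> \<tau>2' v i = cond_marginal \<mu> (\<sigma> ++ \<tau>2) v i"
    using ext[OF \<tau>(2)] by blast
  have dom\<tau>: "dom \<tau>1 = gsphere S v l - dom \<sigma>" "dom \<tau>2 = gsphere S v l - dom \<sigma>"
    using fillingD(1)[OF \<sigma>] \<tau> configs_dom by blast+
  obtain w where w: "\<tau>1 w \<noteq> \<tau>2 w" using False by (auto simp: fun_eq_iff)
  then have "w \<in> dom \<tau>1 \<or> w \<in> dom \<tau>2" by (metis domIff)
  then have wS: "w \<in> gsphere S v l" "w \<in> dom \<tau>1" "w \<in> dom \<tau>2" using dom\<tau> by auto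
  have w': "\<tau>1' w \<noteq> \<tau>2' w"
    using w wS \<tau>1'(3)[of w] \<tau>2'(3)[of w] by (auto simp: map_add_dom_app_simps)
  have inf: "(INF w \<in> {w\<in>W. \<tau>1' w \<noteq> \<tau>2' w}. gdist S v w) = enat l"
  proof (rule antisym)
    have "gdist S v w = enat l" using wS(1) by (simp add: gsphere_def)
    moreover have "(INF w \<in> {w\<in>W. \<tau>1' w \<noteq> \<tau>2' w}. gdist S v w) \<le> gdist S v w"
      by (rule INF_lower) (use w' wS W in auto)
    ultimately show "(INF w \<in> {w\<in>W. \<tau>1' w \<noteq> \<tau>2' w}. gdist S v w) \<le> enat l" by simp
    show "enat l \<le> (INF w \<in> {w\<in>W. \<tau>1' w \<noteq> \<tau>2' w}. gdist S v w)"
    proof (rule INF_greatest)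
      fix x assume x: "x \<in> {w\<in>W. \<tau>1' w \<noteq> \<tau>2' w}"
      \<comment> \<open>Inside the ball both extensions follow \<open>\<sigma>\<close>, because the
        fillings live on the sphere.\<close>
      have "x \<notin> B"
      proof
        assume xB: "x \<in> B"
        then have "x \<notin> dom \<tau>1" "x \<notin> dom \<tau>2" using dom\<tau> B(5) by auto
        then have "(\<sigma> ++ \<tau>1) x = (\<sigma> ++ \<tau>2) x" by (simp add: map_add_dom_app_simps)
        then show False using x xB \<tau>1'(3)[of x] \<tau>2'(3)[of x] by simp
      qed
      then show "enat l \<le> gdist S v x" using x W by (auto simp: B_def gball_def)
    qed
  qed
  have "verts S - W \<subseteq> B" "v \<in> verts S - W" using v B by (auto simp: W_def)
  moreover from this have "finite (verts S - W)" using B finite_subset by blast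
  moreover have "\<tau>1' \<noteq> \<tau>2'" using w' by auto
  ultimately have "d_TV S (cond_marginal \<mu> \<tau>1' v) (cond_marginal \<mu> \<tau>2' v) \<le> f l"
    using ssm \<tau>1'(1,2) \<tau>2'(1,2) W(1) inf unfolding strong_spatial_mixing_def by blast
  then show ?thesis by (simp add: d_TV_def \<tau>1'(4) \<tau>2'(4))
qed

lemma p_low_attained:
  assumes "good \<sigma>" "v \<in> verts S"
  shows "\<exists>\<tau>\<in>fillings \<sigma> v. p_low S \<mu> l \<sigma> v i = cond_marginal \<mu> (\<sigma> ++ \<tau>) v i"
proof -
  obtain \<tau> where "\<tau> \<in> fillings \<sigma> v" using positive_filling[OF assms] by blast
  then have "p_low S \<mu> l \<sigma> v i \<in> (\<lambda>\<tau>. cond_marginal \<mu> (\<sigma> ++ \<tau>) v i) ` fillings \<sigma> v"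
    unfolding p_low_def fillings_def[symmetric]
    by (intro Min_in finite_imageI finite_fillings assms) blast
  then show ?thesis by blast
qed

lemma p_low_le:
  "v \<in> verts S \<Longrightarrow> \<tau> \<in> fillings \<sigma> v \<Longrightarrow> p_low S \<mu> l \<sigma> v i \<le> cond_marginal \<mu> (\<sigma> ++ \<tau>) v i"
  unfolding p_low_def fillings_def[symmetric]
  by (intro Min_le finite_imageI finite_fillings) auto

lemma p_low_nonneg:
  "good \<sigma> \<Longrightarrow> v \<in> verts S \<Longrightarrow> 0 \<le> p_low S \<mu> l \<sigma> v i"
  using p_low_attained[of \<sigma> v i] filling_nonneg by force

text \<open>The marginals of one reference filling \<open>\<tau>\<close> sum to 1. The minimum for
  spin \<open>i\<close> is attained at a filling depending on \<open>i\<close>, but always within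
  \<open>f l\<close> of the reference, so the total loss over the spins is at most
  \<open>q * f l\<close>.\<close>

lemma sum_p_low_ge:
  assumes \<sigma>: "good \<sigma>" "v \<in> verts S" "v \<notin> dom \<sigma>"
  shows "1 - real (nspins S) * f l \<le> (\<Sum>i\<in>spins S. p_low S \<mu> l \<sigma> v i)"
proof -
  obtain \<tau> where \<tau>: "\<tau> \<in> fillings \<sigma> v" using positive_filling[OF \<sigma>(1,2)] by blast
  have "cond_marginal \<mu> (\<sigma> ++ \<tau>) v i - f l \<le> p_low S \<mu> l \<sigma> v i" if i: "i \<in> spins S" for i
  proof -
    obtain \<tau>' where \<tau>': "\<tau>' \<in> fillings \<sigma> v" "p_low S \<mu> l \<sigma> v i = cond_marginal \<mu> (\<sigma> ++ \<tau>') v i"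
      using p_low_attained[OF \<sigma>(1,2)] by blast
    have "\<bar>cond_marginal \<mu> (\<sigma> ++ \<tau>) v i - cond_marginal \<mu> (\<sigma> ++ \<tau>') v i\<bar>
        \<le> d_TV S (cond_marginal \<mu> (\<sigma> ++ \<tau>) v) (cond_marginal \<mu> (\<sigma> ++ \<tau>') v)"
      by (rule abs_diff_le_d_TV[OF _ i]) (simp only: filling_sum[OF \<sigma>(1,2) \<tau>] filling_sum[OF \<sigma>(1,2) \<tau>'(1)])
    also have "\<dots> \<le> f l" by (rule filling_dist[OF \<sigma> \<tau> \<tau>'(1)])
    finally show ?thesis using \<tau>'(2) by linarith
  qed
  then have "(\<Sum>i\<in>spins S. cond_marginal \<mu> (\<sigma> ++ \<tau>) v i - f l) \<le> (\<Sum>i\<in>spins S. p_low S \<mu> l \<sigma> v i)"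
    by (rule sum_mono)
  then show ?thesis using filling_sum[OF \<sigma>(1,2) \<tau>] by (simp add: sum_subtractf)
qed

end


section \<open>The dominating walk\<close>

text \<open>Here \<open>z\<close> counts the calls that are pending besides the one reading \<open>y\<close>.\<close>

definition walk_step :: "real \<Rightarrow> nat \<Rightarrow> nat \<Rightarrow> real \<Rightarrow> nat" where
  "walk_step a M z y = (if y < a then z else z + M)"

text \<open>The hitting time as a budget \<open>k\<close>: a budget can be split among successive
  calls, and it gives the runs something to induct on before termination is known.\<close>

primrec hits_within :: "real \<Rightarrow> nat \<Rightarrow> nat \<Rightarrow> nat \<Rightarrow> real stream \<Rightarrow> bool" where
  "hits_within a M 0 z ys \<longleftrightarrow> z = 0"
| "hits_within a M (Suc k) z ys \<longleftrightarrow>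
     (case z of 0 \<Rightarrow> True | Suc z' \<Rightarrow> hits_within a M k (walk_step a M z' (shd ys)) (stl ys))"

text \<open>The minimum of \<open>n\<close> and the hitting time of 0 from \<open>z\<close>; unlike
  the predicate above, it can be integrated.\<close>

primrec truncated_time :: "real \<Rightarrow> nat \<Rightarrow> nat \<Rightarrow> nat \<Rightarrow> real stream \<Rightarrow> nat" where
  "truncated_time a M 0 z ys = 0"
| "truncated_time a M (Suc n) z ys =
     (case z of 0 \<Rightarrow> 0 | Suc z' \<Rightarrow> Suc (truncated_time a M n (walk_step a M z' (shd ys)) (stl ys)))"

definition hitting_time :: "real \<Rightarrow> nat \<Rightarrow> real stream \<Rightarrow> ennreal" where
  "hitting_time a M ys = (SUP n. of_nat (truncated_time a M n 1 ys))"

lemma hits_within_zero [simp]: "hits_within a M k 0 ys"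
  by (cases k) auto

text \<open>On the same tape the lower walk stays below. This covers calls that recurse less often
  than the walk allows.\<close>

lemma hits_within_mono:
  "hits_within a M k z ys \<Longrightarrow> k \<le> k' \<Longrightarrow> z' \<le> z \<Longrightarrow> hits_within a M k' z' ys"
proof (induction k arbitrary: z z' k' ys)
  case (Suc k)
  show ?case
  proof (cases z')
    case (Suc z1)
    then obtain z2 where z: "z = Suc z2" "z1 \<le> z2" using Suc.prems(3) by (cases z) auto
    obtain k1 where k: "k' = Suc k1" "k \<le> k1" using Suc.prems(2) by (cases k') auto
    have "hits_within a M k1 (walk_step a M z1 (shd ys)) (stl ys)"
      by (rule Suc.IH[of "walk_step a M z2 (shd ys)"]) (use Suc.prems(1) z k in \<open>auto simp: walk_step_def\<close>)
    then show ?thesis using Suc k by simp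
  qed simp
qed simp

text \<open>The truncated time never exceeds \<open>n\<close>, so only a bound strictly below
  \<open>n\<close> shows that the walk really reached 0.\<close>

lemma hits_within_if_truncated_time_le:
  "truncated_time a M n z ys \<le> k \<Longrightarrow> k < n \<Longrightarrow> hits_within a M k z ys"
proof (induction n arbitrary: z ys k)
  case (Suc n)
  then show ?case by (cases z; cases k) auto
qed simp

lemma truncated_time_mono: "truncated_time a M n z ys \<le> truncated_time a M (Suc n) z ys"
proof (induction n arbitrary: z ys)
  case (Suc n)
  show ?case
  proof (cases z)
    case (Suc z')
    then show ?thesis using Suc.IH[of "walk_step a M z' (shd ys)" "stl ys"]
      by (simp del: truncated_time.simps add: truncated_time.simps(2)[of _ _ _ "Suc z'"])
  qed simp
qed simp

text \<open>An infinite hitting time bounds anything, including the cost of a nonterminating run. If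
  it is finite, the truncated times are bounded naturals; their maximum is attained and is itself a
  sufficient budget.\<close>

lemma le_hitting_time:
  assumes "\<And>k. hits_within a M k 1 ys \<Longrightarrow> c \<le> of_nat k"
  shows "c \<le> hitting_time a M ys"
proof (cases "hitting_time a M ys = \<top>")
  case False
  define X where "X = range (\<lambda>n. truncated_time a M n 1 ys)"
  obtain N :: nat where N: "hitting_time a M ys < of_nat N"
    using False ennreal_Ex_less_of_nat by (auto simp: top.not_eq_extremum)
  have le: "of_nat (truncated_time a M n 1 ys) \<le> hitting_time a M ys" for n
    unfolding hitting_time_def by (rule SUP_upper) simp
  have bnd: "truncated_time a M n 1 ys \<le> N" for n
    using le_less_trans[OF le N, of n] by simp
  have X: "finite X" "X \<noteq> {}"
    using bnd by (auto simp: X_def finite_nat_set_iff_bounded_le)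
  then obtain n0 where n0: "Max X = truncated_time a M n0 1 ys"
    using Max_in[OF X] unfolding X_def by blast
  have "hits_within a M (Max X) 1 ys"
    by (rule hits_within_if_truncated_time_le[of _ _ "Suc (Max X)"])
      (use X in \<open>auto simp: X_def simp del: truncated_time.simps\<close>)
  then show ?thesis using assms le[of n0] unfolding n0 by (metis order_trans)
qed simp

section \<open>Random tapes and the expected hitting time\<close>

abbreviation unif :: "real measure" where
  "unif \<equiv> uniform_measure lborel {0..1}"

lemma prob_space_unif: "prob_space unif"
  by (rule prob_space_uniform_measure) auto

text \<open>Only an inequality, because \<open>\<epsilon>\<close> may exceed 1; the threshold is
  then negative.\<close>

lemma unif_tail: "0 \<le> \<epsilon> \<Longrightarrow> emeasure unif {1 - \<epsilon>..} \<le> ennreal \<epsilon>"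
proof -
  assume "0 \<le> \<epsilon>"
  have "emeasure unif {1 - \<epsilon>..} = emeasure lborel ({0..1} \<inter> {1 - \<epsilon>..})"
    by (simp add: divide_ennreal_def)
  also have "\<dots> \<le> emeasure lborel {1 - \<epsilon>..1}"
    by (rule emeasure_mono) auto
  also have "\<dots> = ennreal \<epsilon>" using \<open>0 \<le> \<epsilon>\<close> by simp
  finally show ?thesis .
qed

text \<open>Discards the draw 1, which no half-open zone \<open>J_zone\<close> contains for good
  configurations.\<close>

lemma AE_unif_tape: "AE ys in stream_space unif. ys \<in> streams {0..<1}"
proof -
  have "AE x in lborel. x \<in> {0..1::real} \<longrightarrow> 0 \<le> x \<and> x < 1"
    using AE_lborel_singleton[of "1::real"] by eventually_elim auto
  then have "AE x in unif. 0 \<le> x \<and> x < 1"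
    by (intro AE_uniform_measureI) auto
  then have "AE ys in stream_space unif. stream_all (\<lambda>x. 0 \<le> x \<and> x < 1) ys"
    by (intro prob_space.AE_stream_all[OF prob_space_unif]) auto
  then show ?thesis
    by eventually_elim (auto simp: streams_iff_sset stream.pred_set)
qed

lemma measurable_truncated_time [measurable]:
  "truncated_time a M n z \<in> measurable (stream_space unif) (count_space UNIV)"
proof (induction n arbitrary: z)
  case 0
  have "truncated_time a M 0 z = (\<lambda>_. 0)" by auto
  then show ?case by simp
next
  case (Suc n)
  note Suc [measurable]
  have "truncated_time a M (Suc n) z = (case z of 0 \<Rightarrow> (\<lambda>_. 0) | Suc z' \<Rightarrow> (\<lambda>ys. if shd ys < a
      then Suc (truncated_time a M n z' (stl ys)) else Suc (truncated_time a M n (z' + M) (stl ys))))"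
    by (auto simp: walk_step_def fun_eq_iff split: nat.split)
  also have "\<dots> \<in> measurable (stream_space unif) (count_space UNIV)"
    by (cases z; simp; measurable)
  finally show ?case .
qed

text \<open>Each pending call is charged \<open>1 / (1 - \<alpha>)\<close>. One step costs 1 and
  changes the level on average by at most \<open>\<alpha> - 1\<close>, which releases at least that
  cost. Thanks to the truncation this is an induction on \<open>n\<close> that presupposes no finite
  expectation.\<close>

lemma expected_truncated_time:
  assumes \<epsilon>: "0 \<le> \<epsilon>" "\<epsilon> * real M \<le> \<alpha>" and \<alpha>: "\<alpha> < 1"
  shows "(\<integral>\<^sup>+ ys. of_nat (truncated_time (1 - \<epsilon>) M n z ys) \<partial>stream_space unif)
    \<le> ennreal (real z / (1 - \<alpha>))"
proof (induction n arbitrary: z)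
  case (Suc n)
  interpret prob_space unif by (rule prob_space_unif)
  interpret T: prob_space "stream_space unif" by (rule prob_space_stream_space)
  let ?a = "1 - \<epsilon>"
  have unif_UNIV: "emeasure unif UNIV = 1"
    using emeasure_space_1 by (simp del: emeasure_uniform_measure)
  show ?case
  proof (cases z)
    case (Suc z')
    \<comment> \<open>\<open>C\<close> is the step itself plus the charge for the calls left when
      none is added; \<open>D\<close> is the charge for the \<open>M\<close> extra calls, incurred
      only above the threshold.\<close>
    define C where "C = 1 + real z' / (1 - \<alpha>)"
    define D where "D = real M / (1 - \<alpha>)"
    have CD: "0 \<le> C" "0 \<le> D" using \<alpha> by (auto simp: C_def D_def)
    have "(\<integral>\<^sup>+ ys. of_nat (truncated_time ?a M (Suc n) z ys) \<partial>stream_space unif) =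
        (\<integral>\<^sup>+ y. (\<integral>\<^sup>+ X. of_nat (truncated_time ?a M (Suc n) z (y ## X)) \<partial>stream_space unif) \<partial>unif)"
      by (rule nn_integral_stream_space) measurable
    also have "\<dots> = (\<integral>\<^sup>+ y. 1 + (\<integral>\<^sup>+ X. of_nat (truncated_time ?a M n (walk_step ?a M z' y) X) \<partial>stream_space unif) \<partial>unif)"
      by (intro nn_integral_cong) (simp add: Suc nn_integral_add T.emeasure_space_1)
    also have "\<dots> \<le> (\<integral>\<^sup>+ y. ennreal C + ennreal D * indicator {?a..} y \<partial>unif)"
    proof (rule nn_integral_mono)
      fix y
      have "1 + (\<integral>\<^sup>+ X. of_nat (truncated_time ?a M n (walk_step ?a M z' y) X) \<partial>stream_space unif)
          \<le> 1 + ennreal (real (walk_step ?a M z' y) / (1 - \<alpha>))"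
        by (intro add_left_mono Suc.IH)
      also have "\<dots> = ennreal (1 + real (walk_step ?a M z' y) / (1 - \<alpha>))"
        using \<alpha> by simp
      also have "\<dots> = ennreal (C + D * indicator {?a..} y)"
        by (auto simp: C_def D_def walk_step_def add_divide_distrib add.assoc split: split_indicator)
      also have "\<dots> = ennreal C + ennreal D * indicator {?a..} y"
        using CD by (auto split: split_indicator)
      finally show "1 + (\<integral>\<^sup>+ X. of_nat (truncated_time ?a M n (walk_step ?a M z' y) X) \<partial>stream_space unif)
          \<le> ennreal C + ennreal D * indicator {?a..} y" .
    qed
    also have "\<dots> = ennreal C + ennreal D * emeasure unif {?a..}"
      by (subst nn_integral_add) (simp_all add: nn_integral_cmult_indicator unif_UNIV del: emeasure_uniform_measure)
    also have "\<dots> \<le> ennreal C + ennreal D * ennreal \<epsilon>"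
      by (intro add_left_mono mult_left_mono unif_tail \<epsilon>) simp
    also have "\<dots> = ennreal (C + D * \<epsilon>)"
      using CD \<epsilon> by (simp add: ennreal_mult)
    also have "\<dots> \<le> ennreal (real z / (1 - \<alpha>))"
    proof (rule ennreal_leI)
      have "C + D * \<epsilon> = (1 - \<alpha> + real z' + \<epsilon> * real M) / (1 - \<alpha>)"
        using \<alpha> by (simp add: C_def D_def add_divide_distrib mult.commute)
      also have "\<dots> \<le> real z / (1 - \<alpha>)"
        using \<epsilon> \<alpha> by (intro divide_right_mono) (auto simp: Suc)
      finally show "C + D * \<epsilon> \<le> real z / (1 - \<alpha>)" .
    qed
    finally show ?thesis .
  qed simp
qed simp

lemma expected_hitting_time:
  assumes "0 \<le> \<epsilon>" "\<epsilon> * real M \<le> \<alpha>" "\<alpha> < 1"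
  shows "(\<integral>\<^sup>+ ys. hitting_time (1 - \<epsilon>) M ys \<partial>stream_space unif) \<le> ennreal (1 / (1 - \<alpha>))"
proof -
  have "(\<integral>\<^sup>+ ys. hitting_time (1 - \<epsilon>) M ys \<partial>stream_space unif) =
      (SUP n. \<integral>\<^sup>+ ys. of_nat (truncated_time (1 - \<epsilon>) M n 1 ys) \<partial>stream_space unif)"
    unfolding hitting_time_def
  proof (rule nn_integral_monotone_convergence_SUP)
    show "incseq (\<lambda>n ys. of_nat (truncated_time (1 - \<epsilon>) M n 1 ys) :: ennreal)"
      by (intro incseq_SucI le_funI) (simp only: of_nat_le_iff truncated_time_mono)
  qed measurable
  also have "\<dots> \<le> ennreal (1 / (1 - \<alpha>))"
    using expected_truncated_time[OF assms, of _ 1] by (intro SUP_least) simp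
  finally show ?thesis .
qed


section \<open>Domination of the algorithm\<close>

text \<open>Takes an index where the partial sums first pass \<open>y\<close>. The terms may have
  any sign, so the cover by \<open>J_zone\<close> does not require \<open>rho\<close> to be
  nonnegative. The offset \<open>s\<close> serves both kinds of zones.\<close>

lemma partial_sum_bracket:
  fixes p :: "nat \<Rightarrow> real"
  assumes "s \<le> y" "y < s + (\<Sum>j\<in>{1..q}. p j)"
  shows "\<exists>i\<in>{1..q}. s + (\<Sum>j\<in>{1..<i}. p j) \<le> y \<and> y < s + (\<Sum>j\<in>{1..i}. p j)"
  using assms(2)
proof (induction q)
  case (Suc q)
  show ?case
  proof (cases "y < s + (\<Sum>j\<in>{1..q}. p j)")
    case True
    then show ?thesis using Suc.IH by fastforce
  next
    case False
    then show ?thesis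
      using Suc.prems by (intro bexI[of _ "Suc q"]) (simp_all add: atLeastLessThanSuc_atLeastAtMost)
  qed
qed (use assms(1) in simp)

lemma sum_upto_split:
  fixes p :: "nat \<Rightarrow> real"
  assumes "1 \<le> i"
  shows "(\<Sum>j\<in>{1..i}. p j) = (\<Sum>j\<in>{1..<i}. p j) + p i"
  using assms by (cases i) (simp_all add: atLeastLessThanSuc_atLeastAtMost)

section \<open>The zones of a single draw\<close>

context ssm_system
begin

lemma p_low_pos_if_I_zone:
  "i \<in> spins S \<Longrightarrow> y \<in> I_zone S \<mu> l \<sigma> v i \<Longrightarrow> 0 < p_low S \<mu> l \<sigma> v i"
  using sum_upto_split[of i "p_low S \<mu> l \<sigma> v"] by (auto simp: I_zone_def)

lemma rho_pos_if_J_zone: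
  "i \<in> spins S \<Longrightarrow> y \<in> J_zone S \<mu> l \<sigma> \<sigma>' v i \<Longrightarrow> 0 < rho S \<mu> l \<sigma> \<sigma>' v i"
  using sum_upto_split[of i "rho S \<mu> l \<sigma> \<sigma>' v"] by (auto simp: J_zone_def)

text \<open>A nonempty zone has positive length, so the minimum is positive and spin
  \<open>i\<close> has positive marginal under every filling, in particular under one of positive
  probability.\<close>

lemma good_I_zone:
  assumes "good \<sigma>" "v \<in> verts S" "v \<notin> dom \<sigma>" "i \<in> spins S" "y \<in> I_zone S \<mu> l \<sigma> v i"
  shows "good (\<sigma>(v \<mapsto> i))"
proof -
  obtain \<tau> where \<tau>: "\<tau> \<in> fillings \<sigma> v" "marginal \<mu> (\<sigma> ++ \<tau>) > 0"
    using positive_filling[OF assms(1,2)] by blast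
  have "dom \<sigma> \<inter> dom \<tau> = {}" using configs_dom[OF fillingD(1)[OF assms(1) \<tau>(1)]] by auto
  then have "\<sigma> \<subseteq>\<^sub>m \<sigma> ++ \<tau>" by (metis map_add_comm map_le_map_add)
  moreover have "0 < cond_marginal \<mu> (\<sigma> ++ \<tau>) v i"
    using p_low_pos_if_I_zone[OF assms(4,5)] p_low_le[OF assms(2) \<tau>(1), of i] by linarith
  ultimately show ?thesis
    using good_upd[OF assms(1-4)] fillingD(4)[OF assms(1) \<tau>(1)] \<tau>(2) by blast
qed

lemma good_J_zone:
  assumes "good \<sigma>" "v \<in> verts S" "v \<notin> dom \<sigma>" "i \<in> spins S" "y \<in> J_zone S \<mu> l \<sigma> \<sigma>' v i"
    and "good \<sigma>'" "\<sigma> \<subseteq>\<^sub>m \<sigma>'"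
  shows "good (\<sigma>(v \<mapsto> i))"
proof -
  have "0 < cond_marginal \<mu> \<sigma>' v i"
    using rho_pos_if_J_zone[OF assms(4,5)] p_low_nonneg[OF assms(1,2), of i] by (simp add: rho_def)
  then show ?thesis
    using good_upd[OF assms(1-4,7)] goodD[OF assms(6)] by blast
qed

lemma I_zone_cover:
  assumes "0 \<le> y" "y < (\<Sum>j\<in>spins S. p_low S \<mu> l \<sigma> v j)"
  shows "\<exists>i\<in>spins S. y \<in> I_zone S \<mu> l \<sigma> v i"
  using partial_sum_bracket[of 0 y "p_low S \<mu> l \<sigma> v" "nspins S"] assms by (auto simp: I_zone_def)

text \<open>The marginals given \<open>\<sigma>'\<close> sum to 1, so adding the sums of
  \<open>rho\<close> and \<open>p_low\<close> ends the last zone exactly at 1.\<close>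

lemma J_zone_cover:
  assumes "good \<sigma>'" "v \<in> verts S" "(\<Sum>j\<in>spins S. p_low S \<mu> l \<sigma> v j) \<le> y" "y < 1"
  shows "\<exists>i\<in>spins S. y \<in> J_zone S \<mu> l \<sigma> \<sigma>' v i"
proof -
  have "(\<Sum>i\<in>spins S. cond_marginal \<mu> \<sigma>' v i) = 1"
    using sum_cond_at[OF goodD(1,3)[OF assms(1)] assms(2)]
    by (simp only: cond_at_def cond_marginal_pos[OF gibbs countable_verts goodD(1,3)[OF assms(1)] assms(2)])
  then have "y < (\<Sum>j\<in>spins S. p_low S \<mu> l \<sigma> v j) + (\<Sum>j\<in>spins S. rho S \<mu> l \<sigma> \<sigma>' v j)"
    using assms(4) by (simp add: rho_def sum_subtractf)
  from partial_sum_bracket[OF assms(3) this] show ?thesis by (simp add: J_zone_def)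
qed

end

section \<open>Runs on a fixed tape\<close>

locale ssms_run = ssm_system S \<mu> f l
  for S :: "'v spin_system" and \<mu> :: "('v \<Rightarrow> nat) measure" and f :: "nat \<Rightarrow> real" and l :: nat +
  fixes enum :: "'v config \<Rightarrow> 'v \<Rightarrow> 'v list" and M :: nat
  assumes enum: "u \<in> verts S \<Longrightarrow> distinct (enum \<tau> u) \<and> set (enum \<tau> u) = gsphere S u l - dom \<tau>"
    and card_gsphere: "u \<in> verts S \<Longrightarrow> card (gsphere S u l) \<le> M"
begin

abbreviation "threshold \<equiv> 1 - real (nspins S) * f l"

abbreviation "tapes \<equiv> streams {0..<1 :: real}"

text \<open>The parameter \<open>z\<close> stands for the calls still pending at outer levels of the recursion; the
  induction on the length of the walk needs it.\<close>

definition completes :: "('v config \<Rightarrow> 'v \<Rightarrow> real stream \<Rightarrow> 'v outcome) \<Rightarrow> nat \<Rightarrow> bool" where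
  "completes F k \<longleftrightarrow> (\<forall>\<sigma> v ys z. good \<sigma> \<and> v \<in> verts S - dom \<sigma> \<and> ys \<in> tapes \<and>
     hits_within threshold M k (Suc z) ys \<longrightarrow>
     (\<exists>i n ys'. F \<sigma> v ys = Some (\<sigma>(v \<mapsto> i), n, ys') \<and> n \<le> k \<and> good (\<sigma>(v \<mapsto> i)) \<and> ys' \<in> tapes \<and>
        hits_within threshold M (k - n) z ys'))"

lemma completesE:
  assumes "completes F k" "good \<sigma>" "v \<in> verts S - dom \<sigma>" "ys \<in> tapes"
    and "hits_within threshold M k (Suc z) ys"
  obtains i n ys' where "F \<sigma> v ys = Some (\<sigma>(v \<mapsto> i), n, ys')" "n \<le> k" "good (\<sigma>(v \<mapsto> i))"
    "ys' \<in> tapes" "hits_within threshold M (k - n) z ys'"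
  using assms unfolding completes_def by blast

text \<open>While one vertex is processed, the rest of the list counts as pending along with
  \<open>z\<close>. Each call hands on what is left of the budget, hence the assumption for all
  smaller budgets; distinctness keeps later vertices unassigned.\<close>

lemma completes_call_seq:
  assumes "\<And>k'. k' \<le> k \<Longrightarrow> completes F k'"
    and "distinct ws" "set ws \<subseteq> verts S - dom \<sigma>" "good \<sigma>" "ys \<in> tapes"
    and "hits_within threshold M k (length ws + z) ys"
  shows "\<exists>\<sigma>' n ys'. call_seq F ws \<sigma> ys = Some (\<sigma>', n, ys') \<and> n \<le> k \<and> good \<sigma>' \<and> \<sigma> \<subseteq>\<^sub>m \<sigma>' \<and>
     ys' \<in> tapes \<and> hits_within threshold M (k - n) z ys'"
  using assms
proof (induction ws arbitrary: \<sigma> ys k)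
  case Nil
  then show ?case by simp
next
  case (Cons w ws)
  have "completes F k" using Cons.prems(1) by simp
  moreover have "hits_within threshold M k (Suc (length ws + z)) ys" using Cons.prems(6) by simp
  moreover have "w \<in> verts S - dom \<sigma>" using Cons.prems(3) by simp
  ultimately obtain i n ys' where 1: "F \<sigma> w ys = Some (\<sigma>(w \<mapsto> i), n, ys')" "n \<le> k" "good (\<sigma>(w \<mapsto> i))"
      "ys' \<in> tapes" "hits_within threshold M (k - n) (length ws + z) ys'"
    using completesE Cons.prems(4,5) by metis
  have "\<exists>\<sigma>' n' ys''. call_seq F ws (\<sigma>(w \<mapsto> i)) ys' = Some (\<sigma>', n', ys'') \<and> n' \<le> k - n \<and>
      good \<sigma>' \<and> \<sigma>(w \<mapsto> i) \<subseteq>\<^sub>m \<sigma>' \<and> ys'' \<in> tapes \<and> hits_within threshold M (k - n - n') z ys''"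
  proof (rule Cons.IH)
    show "completes F k'" if "k' \<le> k - n" for k' using Cons.prems(1) that by simp
    show "set ws \<subseteq> verts S - dom (\<sigma>(w \<mapsto> i))"
      using Cons.prems(2,3) by (simp add: subset_Diff_insert)
    show "distinct ws" using Cons.prems(2) by simp
  qed (fact 1)+
  then obtain \<sigma>' n' ys'' where 2: "call_seq F ws (\<sigma>(w \<mapsto> i)) ys' = Some (\<sigma>', n', ys'')" "n' \<le> k - n"
      "good \<sigma>'" "\<sigma>(w \<mapsto> i) \<subseteq>\<^sub>m \<sigma>'" "ys'' \<in> tapes" "hits_within threshold M (k - n - n') z ys''"
    by blast
  have "w \<notin> dom \<sigma>" using Cons.prems(3) by auto
  then have "\<sigma> \<subseteq>\<^sub>m \<sigma>(w \<mapsto> i)" by (auto simp: map_le_def)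
  then have "\<sigma> \<subseteq>\<^sub>m \<sigma>'" using 2(4) map_le_trans by blast
  then show ?case using 1 2 by simp
qed

text \<open>The current call consumes one tape entry and one unit of budget, so its recursive calls
  fall under the induction hypothesis although the recursion itself has no termination
  measure.\<close>

lemma completes_ssms: "completes (ssms S \<mu> enum l) k"
proof (induction k rule: less_induct)
  case (less k)
  show ?case unfolding completes_def
  proof (intro allI impI, elim conjE)
    fix \<sigma> v ys z
    assume \<sigma>: "good \<sigma>" and v: "v \<in> verts S - dom \<sigma>" and ys: "ys \<in> tapes"
      and h: "hits_within threshold M k (Suc z) ys"
    have v': "v \<in> verts S" "v \<notin> dom \<sigma>" using v by auto
    obtain k0 where k: "k = Suc k0" using h by (cases k) auto
    define y where "y = shd ys"
    have y: "0 \<le> y" "y < 1" and tl: "stl ys \<in> tapes"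
      using ys unfolding y_def by (metis streamsE shd_sset stream.collapse atLeastLessThan_iff streams_stl streams_shd)+
    have h0: "hits_within threshold M k0 (walk_step threshold M z y) (stl ys)"
      using h by (simp add: k y_def)
    let ?inI = "\<exists>i\<in>spins S. y \<in> I_zone S \<mu> l \<sigma> v i"
    show "\<exists>i n ys'. ssms S \<mu> enum l \<sigma> v ys = Some (\<sigma>(v \<mapsto> i), n, ys') \<and> n \<le> k \<and> good (\<sigma>(v \<mapsto> i)) \<and>
        ys' \<in> tapes \<and> hits_within threshold M (k - n) z ys'"
    proof (cases ?inI)
      case True
      define i where "i = (SOME i. i \<in> spins S \<and> y \<in> I_zone S \<mu> l \<sigma> v i)"
      have i: "i \<in> spins S \<and> y \<in> I_zone S \<mu> l \<sigma> v i"
        unfolding i_def by (rule someI_ex) (use True in blast)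
      have "ssms S \<mu> enum l \<sigma> v ys = Some (\<sigma>(v \<mapsto> i), 1, stl ys)"
        by (subst ssms.simps) (simp only: Let_def y_def[symmetric] True if_True i_def)
      moreover have "good (\<sigma>(v \<mapsto> i))" using good_I_zone[OF \<sigma> v'] i by blast
      \<comment> \<open>The draw may lie above the threshold and still in some
        \<open>I_zone\<close>. The walk has then gone up while the run has not, and monotonicity
        bridges the gap.\<close>
      moreover have "hits_within threshold M (k - 1) z (stl ys)"
        using hits_within_mono[OF h0, of k0 z] by (simp add: k walk_step_def)
      ultimately show ?thesis using tl k by (metis le_add1 plus_1_eq_Suc)
    next
      case False
      have low: "(\<Sum>j\<in>spins S. p_low S \<mu> l \<sigma> v j) \<le> y"
        using I_zone_cover[OF y(1), of \<sigma> v] False by linarith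
      then have "\<not> y < threshold" using sum_p_low_ge[OF \<sigma> v'] by linarith
      then have h1: "hits_within threshold M k0 (z + M) (stl ys)" using h0 by (simp add: walk_step_def)
      have en: "distinct (enum \<sigma> v)" "set (enum \<sigma> v) = gsphere S v l - dom \<sigma>"
        using enum[OF v'(1)] by auto
      have "length (enum \<sigma> v) = card (gsphere S v l - dom \<sigma>)"
        using distinct_card[OF en(1)] en(2) by simp
      also have "\<dots> \<le> M"
        using card_mono[OF finite_gsphere[OF v'(1)] Diff_subset] card_gsphere[OF v'(1)]
        by (rule order_trans)
      finally have h2: "hits_within threshold M k0 (length (enum \<sigma> v) + z) (stl ys)"
        by (intro hits_within_mono[OF h1]) auto
      have "\<exists>\<sigma>' n ys'. call_seq (ssms S \<mu> enum l) (enum \<sigma> v) \<sigma> (stl ys) = Some (\<sigma>', n, ys') \<and>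
          n \<le> k0 \<and> good \<sigma>' \<and> \<sigma> \<subseteq>\<^sub>m \<sigma>' \<and> ys' \<in> tapes \<and> hits_within threshold M (k0 - n) z ys'"
      proof (rule completes_call_seq)
        show "completes (ssms S \<mu> enum l) k'" if "k' \<le> k0" for k'
          using less.IH that k by simp
        show "set (enum \<sigma> v) \<subseteq> verts S - dom \<sigma>" unfolding en(2) using gsphere_verts by blast
      qed (use en(1) \<sigma> tl h2 in auto)
      then obtain \<sigma>' n ys' where c: "call_seq (ssms S \<mu> enum l) (enum \<sigma> v) \<sigma> (stl ys) = Some (\<sigma>', n, ys')"
          "n \<le> k0" "good \<sigma>'" "\<sigma> \<subseteq>\<^sub>m \<sigma>'" "ys' \<in> tapes" "hits_within threshold M (k0 - n) z ys'"
        by blast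
      define i where "i = (SOME i. i \<in> spins S \<and> y \<in> J_zone S \<mu> l \<sigma> \<sigma>' v i)"
      have i: "i \<in> spins S \<and> y \<in> J_zone S \<mu> l \<sigma> \<sigma>' v i"
        unfolding i_def by (rule someI_ex) (use J_zone_cover[OF c(3) v'(1) low y(2)] in blast)
      have "ssms S \<mu> enum l \<sigma> v ys = Some (\<sigma>(v \<mapsto> i), 1 + n, ys')"
        by (subst ssms.simps)
          (simp only: Let_def y_def[symmetric] False if_False c(1) Option.bind.simps prod.case i_def)
      moreover have "good (\<sigma>(v \<mapsto> i))" using good_J_zone[OF \<sigma> v'] i c(3,4) by blast
      moreover have "1 + n \<le> k" "k - (1 + n) = k0 - n" using c(2) k by auto
      ultimately show ?thesis using c(5,6) by metis
    qed
  qed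
qed

text \<open>The outermost call has nothing else pending, so \<open>z = 0\<close> and the walk starts
  at 1.\<close>

lemma ssms_calls_le_hitting_time:
  assumes "good \<sigma>" "v \<in> verts S - dom \<sigma>" "ys \<in> tapes"
  shows "ssms_calls S \<mu> enum l \<sigma> v ys \<le> hitting_time threshold M ys"
proof (rule le_hitting_time)
  fix k assume "hits_within threshold M k 1 ys"
  then have "hits_within threshold M k (Suc 0) ys" by simp
  then obtain i n ys' where "ssms S \<mu> enum l \<sigma> v ys = Some (\<sigma>(v \<mapsto> i), n, ys')" "n \<le> k"
    using completesE[OF completes_ssms assms] by metis
  then show "ssms_calls S \<mu> enum l \<sigma> v ys \<le> of_nat k" by (simp add: ssms_calls_def)
qed

end

theorem theorem1:
  fixes S :: "'v spin_system" and \<mu> :: "('v \<Rightarrow> nat) measure"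
    and f g :: "nat \<Rightarrow> real" and \<alpha> :: real and l :: nat
    and enum :: "'v config \<Rightarrow> 'v \<Rightarrow> 'v list"
    and v :: 'v and \<Lambda> :: "'v set" and \<sigma> :: "'v config"
  assumes "spin_system S" and "gibbs_measure S \<mu>"
    and "\<And>n. 0 \<le> f n" and "strong_spatial_mixing S \<mu> f"
    and "\<And>u n. u \<in> verts S \<Longrightarrow> real (card (gsphere S u n)) \<le> g n"
    and "1 \<le> l" and "real (nspins S) * f l * g l \<le> \<alpha>" and "\<alpha> < 1"
    and "\<And>\<tau> u. u \<in> verts S \<Longrightarrow> distinct (enum \<tau> u) \<and> set (enum \<tau> u) = gsphere S u l - dom \<tau>"
    and "v \<in> verts S" and "\<Lambda> \<subseteq> verts S" and "v \<notin> \<Lambda>"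
    and "\<sigma> \<in> configs S \<Lambda>" and "marginal \<mu> \<sigma> > 0"
  shows "expected_ssms_calls S \<mu> enum l \<sigma> v \<le> ennreal (1 / (1 - \<alpha>))"
proof -
  \<comment> \<open>Sphere sizes are integers, so rounding \<open>g l\<close> down still bounds them
    and can only lower the drift.\<close>
  define M where "M = nat \<lfloor>g l\<rfloor>"
  define \<epsilon> where "\<epsilon> = real (nspins S) * f l"
  have "0 \<le> real (card (gsphere S v l))" by simp
  also have "\<dots> \<le> g l" by (rule assms(5)[OF assms(10)])
  finally have g: "0 \<le> g l" .
  have \<epsilon>: "0 \<le> \<epsilon>" using assms(3) by (simp add: \<epsilon>_def)
  have "\<epsilon> * real M \<le> \<epsilon> * g l" using g by (intro mult_left_mono \<epsilon>) (simp add: M_def)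
  then have \<epsilon>M: "\<epsilon> * real M \<le> \<alpha>" using assms(7) by (simp add: \<epsilon>_def)
  interpret ssms_run S \<mu> f l enum M
  proof unfold_locales
    show "card (gsphere S u l) \<le> M" if "u \<in> verts S" for u
      using assms(5)[OF that, of l] by (simp add: M_def le_nat_floor)
  qed (use assms in auto)
  have dom: "dom \<sigma> = \<Lambda>" using assms(13) by (rule configs_dom)
  then have "good \<sigma>" "v \<in> verts S - dom \<sigma>" using assms(10-14) by (auto simp: good_def)
  then have "AE ys in stream_space unif. ssms_calls S \<mu> enum l \<sigma> v ys \<le> hitting_time (1 - \<epsilon>) M ys"
    using AE_unif_tape by (auto elim!: eventually_mono intro: ssms_calls_le_hitting_time simp: \<epsilon>_def)
  \<comment> \<open>Monotonicity of \<open>nn_integral\<close> asks for no measurability of the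
    number of calls; only the hitting time is shown to be measurable, through its
    truncations.\<close>
  then have "expected_ssms_calls S \<mu> enum l \<sigma> v \<le> (\<integral>\<^sup>+ ys. hitting_time (1 - \<epsilon>) M ys \<partial>stream_space unif)"
    unfolding expected_ssms_calls_def by (rule nn_integral_mono_AE)
  also have "\<dots> \<le> ennreal (1 / (1 - \<alpha>))" by (rule expected_hitting_time[OF \<epsilon> \<epsilon>M assms(8)])
  finally show ?thesis .
qed

end
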